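(* Let $(Z_n)$ be a branching process in an i.i.d. random environment $\xi=(\xi_0,\xi_1,\ldots)$ such that $p_0(\xi_0)=0$ a.s., $\mathbb{E}\log m_0\in(0,\infty)$ and $\gamma=\mathbb{P}(Z_1=1)\in[0,1)$. Assume that $\mathbb{P}(Z_1=1)>0$. For each integer $k\ge1$ let $\gamma_k=\mathbb{P}_k(Z_1=k)=\mathbb{E}[p_1^k(\xi_0)]>0$ and let $r_k>0$ be the solution of the equation $\gamma_k=\mathbb{E}[m_0^{-r_k}]$. Then for any $k\ge1$ the following assertions hold. a) For any accessible state $j\ge k$, in the sense that $\mathbb{P}_k(Z_l=j)>0$ for some $l\ge0$, we have $$\mathbb{P}_k(Z_n=j)\underset{n\to\infty}{\sim}\gamma_k^n\,q_{k,j},$$ where $q_{k,k}=1$ and, for $j>k$, $q_{k,j}\in(0,+\infty)$ is the solution of the recurrence relation $$\gamma_k q_{k,j}=\sum_{i=k}^{j}p(i,j)\,q_{k,i},$$ with $q_{k,i}=0$ for any non-accessible state $i$, i.e. such that $\mathbb{P}_k(Z_l=i)=0$ for all $l\ge0$. b) Assume that there exists $\varepsilon>0$ such that $\mathbb{E}[m_0^{r_k+\varepsilon}]<\infty$. Then, for any $r>r_k$, we have $\sum_{j=k}^{\infty}j^{-r}q_{k,j}<\infty$. In particular, the radius of convergence of the power series $$Q_k(t)=\sum_{j=k}^{+\infty}q_{k,j}t^j$$ is equal to $1$. c) For all $t\in[0,1)$, the sequence $G_{k,n}(t)/\gamma_k^n$ is non-decreasing in $n$ and $$\frac{G_{k,n}(t)}{\gamma_k^n}\uparrow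 Q_k(t)\quad\text{as } n\to\infty,$$ where $G_{k,n}(t)=\mathbb{E}_k[t^{Z_n}]$ is the probability generating function of $Z_n$ when $Z_0=k$. d) $Q_k(t)$ is the unique power series (convergent on $[0,1)$) which satisfies the functional equation $$\gamma_kQ_k(t)=\mathbb{E}\left[Q_k(f_0(t))\right],\quad t\in[0,1),$$ with the condition that its coefficient of $t^k$ equals $1$ (i.e. $Q_k^{(k)}(0)=k!$).
   Context: The random environment $\xi=(\xi_0,\xi_1,\ldots)$ is a sequence of i.i.d. random variables; each realization of $\xi_n$ determines a probability distribution $(p_i(\xi_n))_{i\geq0}$ on the non-negative integers ($p_i(\xi_n)\ge 0$, $\sum_i p_i(\xi_n)=1$), with generating function $f_n(t)=\sum_{i\ge0}p_i(\xi_n)t^i$, $t\in[0,1]$. The branching process in random environment is defined by $Z_0=k$ (with $k\ge1$ an integer; default $k=1$) and $Z_{n+1}=\sum_{i=1}^{Z_n}N_{n,i}$, where, conditionally on $\xi$, the random variables $N_{n,i}$ ($n\ge 0$, $i\ge1$) are independent, and each $N_{n,i}$ has law $(p_j(\xi_n))_{j\ge0}$. $\mathbb{P},\mathbb{E}$ denote total (annealed, i.e. averaged over the environment) probability and expectation when $Z_0=1$; $\mathbb{P}_k,\mathbb{E}_k$ denote annealed probability and expectation when $Z_0=k$. Set $m_n=\sum_{i\ge0}i\,p_i(\xi_n)$, and $p(i,j)=\mathbb{P}_i(Z_1=j)=\mathbb{P}(Z_1=j\mid Z_0=i)$. Notation: $p_1^k(\xi_0)=(p_1(\xi_0))^k$;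 $u_n\sim v_n$ means $u_n/v_n\to1$. The power series $Q_k(t)=\sum_{j\ge k}q_{k,j}t^j$ in c) and d) is the one built from the coefficients $q_{k,j}$ of a) (with $q_{k,j}=0$ for non-accessible $j$). The existence of the solution $r_k$ is part of the setting. *)

theory Defs
  imports "HOL-Probability.Probability"
begin

definition offspring_mean :: "nat pmf \<Rightarrow> real" where
  "offspring_mean D = (\<Sum>i. real i * pmf D i)"

definition offspring_pgf :: "nat pmf \<Rightarrow> real \<Rightarrow> real" where
  "offspring_pgf D t = (\<Sum>i. pmf D i * t ^ i)"

definition power_series :: "(nat \<Rightarrow> real) \<Rightarrow> real \<Rightarrow> real" where
  "power_series a t = (\<Sum>j. a j * t ^ j)"

text \<open>
  The environment \<open>\<xi>\<close> is an i.i.d. sequence with values in a measurable space \<open>E\<close>, and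
  \<open>p e\<close> is the offspring law determined by the environment value \<open>e\<close>.
  The sub-\<open>\<sigma>\<close>-algebra of \<open>M\<close> generated by the whole environment is the following.
\<close>

definition env_algebra :: "'w measure \<Rightarrow> 'e measure \<Rightarrow> (nat \<Rightarrow> 'w \<Rightarrow> 'e) \<Rightarrow> 'w measure" where
  "env_algebra M E \<xi> =
     vimage_algebra (space M) (\<lambda>\<omega> n. \<xi> n \<omega>) (Pi\<^sub>M UNIV (\<lambda>_. E))"

text \<open>
  The assumption \<open>offspring\<close> says that, conditionally on \<open>\<xi>\<close>, the variables \<open>N n i\<close>
  (\<open>n \<ge> 0\<close>, \<open>i \<ge> 1\<close>) are independent and each \<open>N n i\<close> has law \<open>p (\<xi> n)\<close>: since they are
  integer-valued, this is the product form of the conditional joint probability mass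
  function of every finite subfamily.
\<close>

locale branching_random_environment = prob_space M
  for M :: "'w measure"
    and E :: "'e measure"
    and \<xi> :: "nat \<Rightarrow> 'w \<Rightarrow> 'e"
    and p :: "'e \<Rightarrow> nat pmf"
    and N :: "nat \<Rightarrow> nat \<Rightarrow> 'w \<Rightarrow> nat" +
  assumes env_indep: "indep_vars (\<lambda>_. E) \<xi> UNIV"
    and env_ident: "\<And>n. distr M E (\<xi> n) = distr M E (\<xi> 0)"
    and p_measurable: "\<And>i. (\<lambda>e. pmf (p e) i) \<in> borel_measurable E"
    and N_measurable: "\<And>n i. i \<ge> 1 \<Longrightarrow> N n i \<in> measurable M (count_space UNIV)"
    and offspring: "\<And>(I :: (nat \<times> nat) set) (c :: nat \<Rightarrow> nat \<Rightarrow> nat).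
      finite I \<Longrightarrow> I \<subseteq> UNIV \<times> {1..} \<Longrightarrow>
      AE \<omega> in M.
        real_cond_exp M (env_algebra M E \<xi>)
          (indicator {\<omega> \<in> space M. \<forall>(n, i) \<in> I. N n i \<omega> = c n i}) \<omega>
        = (\<Prod>(n, i) \<in> I. pmf (p (\<xi> n \<omega>)) (c n i))"

text \<open>
  \<open>bp N k n\<close> is \<open>Z\<^sub>n\<close> for the process started from \<open>Z\<^sub>0 = k\<close>. The processes with different
  initial states are built from the same variables \<open>N\<close>, so the annealed laws \<open>\<P>\<^sub>k\<close> are
  the laws of \<open>bp N k\<close> under the single probability measure \<open>M\<close>; only these laws are used.
\<close>

primrec bp :: "(nat \<Rightarrow> nat \<Rightarrow> 'w \<Rightarrow> nat) \<Rightarrow> nat \<Rightarrow> nat \<Rightarrow> 'w \<Rightarrow> nat" where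
  "bp N k 0 \<omega> = k"
| "bp N k (Suc n) \<omega> = (\<Sum>i = 1..bp N k n \<omega>. N n i \<omega>)"

text \<open>\<open>bp_prob M N k n j\<close> is \<open>\<P>\<^sub>k(Z\<^sub>n = j)\<close>; in particular \<open>bp_prob M N i 1 j\<close> is \<open>p(i, j)\<close>.\<close>

definition bp_prob :: "'w measure \<Rightarrow> (nat \<Rightarrow> nat \<Rightarrow> 'w \<Rightarrow> nat) \<Rightarrow> nat \<Rightarrow> nat \<Rightarrow> nat \<Rightarrow> real" where
  "bp_prob M N k n j = measure M {\<omega> \<in> space M. bp N k n \<omega> = j}"

definition bp_pgf :: "'w measure \<Rightarrow> (nat \<Rightarrow> nat \<Rightarrow> 'w \<Rightarrow> nat) \<Rightarrow> nat \<Rightarrow> nat \<Rightarrow> real \<Rightarrow> real" where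
  "bp_pgf M N k n t = (\<integral>\<omega>. t ^ bp N k n \<omega> \<partial>M)"

definition bp_gamma :: "'w measure \<Rightarrow> (nat \<Rightarrow> nat \<Rightarrow> 'w \<Rightarrow> nat) \<Rightarrow> nat \<Rightarrow> real" where
  "bp_gamma M N k = bp_prob M N k 1 k"

definition accessible :: "'w measure \<Rightarrow> (nat \<Rightarrow> nat \<Rightarrow> 'w \<Rightarrow> nat) \<Rightarrow> nat \<Rightarrow> nat \<Rightarrow> bool" where
  "accessible M N k j \<longleftrightarrow> (\<exists>l. bp_prob M N k l j > 0)"

text \<open>
  The conditions determining the family \<open>q\<^sub>k\<^sub>,\<^sub>j\<close> for a fixed \<open>k\<close>. It is extended by \<open>0\<close> to
  \<open>j < k\<close>, so that \<open>q\<close> is also the coefficient sequence of \<open>Q\<^sub>k(t) = (\<Sum>j\<ge>k. q\<^sub>k\<^sub>,\<^sub>j t\<^sup>j)\<close>.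
\<close>

definition q_recurrence ::
    "'w measure \<Rightarrow> (nat \<Rightarrow> nat \<Rightarrow> 'w \<Rightarrow> nat) \<Rightarrow> nat \<Rightarrow> (nat \<Rightarrow> real) \<Rightarrow> bool" where
  "q_recurrence M N k q \<longleftrightarrow>
     q k = 1 \<and>
     (\<forall>i. i < k \<or> \<not> accessible M N k i \<longrightarrow> q i = 0) \<and>
     (\<forall>j>k. accessible M N k j \<longrightarrow>
        bp_gamma M N k * q j = (\<Sum>i = k..j. bp_prob M N i 1 j * q i))"

text \<open>
  A power series with arbitrary real coefficients (not assumed to start at \<open>t\<^sup>k\<close> or to be
  nonnegative), convergent on \<open>[0,1)\<close>, with \<open>t\<^sup>k\<close>-coefficient \<open>1\<close>, which solves the functional
  equation. Integrability is stated since the Bochner integral of a non-integrable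
  function is \<open>0\<close> by convention.
\<close>

definition solves_functional_equation ::
    "'w measure \<Rightarrow> (nat \<Rightarrow> 'w \<Rightarrow> 'e) \<Rightarrow> ('e \<Rightarrow> nat pmf) \<Rightarrow> (nat \<Rightarrow> nat \<Rightarrow> 'w \<Rightarrow> nat) \<Rightarrow>
     nat \<Rightarrow> (nat \<Rightarrow> real) \<Rightarrow> bool" where
  "solves_functional_equation M \<xi> p N k a \<longleftrightarrow>
     a k = 1 \<and>
     (\<forall>t\<in>{0..<1}.
        summable (\<lambda>j. a j * t ^ j) \<and>
        integrable M (\<lambda>\<omega>. power_series a (offspring_pgf (p (\<xi> 0 \<omega>)) t)) \<and>
        bp_gamma M N k * power_series a t
          = (\<integral>\<omega>. power_series a (offspring_pgf (p (\<xi> 0 \<omega>)) t) \<partial>M))"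

end

theory Submission
  imports Defs "HOL-Real_Asymp.Real_Asymp"
begin

text \<open>
  With \<open>Z\<close> non-decreasing and Markov under the annealed law, everything is a statement about the
  upper triangular matrix \<open>p(i, j) = \<P>\<^sub>i(Z\<^sub>1 = j)\<close>, whose diagonal entries are
  \<open>\<gamma>\<^sub>i = \<E>[p\<^sub>1(\<xi>\<^sub>0)^i]\<close>.

  Markov property. The offspring rows \<open>(N\<^sub>n\<^sub>,\<^sub>i)\<^sub>i\<close> are independent for different \<open>n\<close>: this is
  the product formula for cylinder events, averaged over the i.i.d. environment
  (\<open>rows_indep\<close>). Since \<open>Z\<^sub>n\<close> is a function of the rows before \<open>n\<close>, the law of \<open>Z\<^sub>n\<close> is the
  \<open>k\<close>-th row of the \<open>n\<close>-th matrix power (\<open>bp_prob_Suc_sums\<close>, \<open>bp_prob_eq_row\<close>).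

  Strict monotonicity of the diagonal. The sequence \<open>\<gamma>\<^sub>i\<close> is strictly decreasing as soon as
  \<open>p\<^sub>1(\<xi>\<^sub>0)\<close> takes values in \<open>(0, 1)\<close> with positive probability. This is where the existence of
  \<open>r\<^sub>1\<close> enters: if \<open>p\<^sub>1\<close> were almost surely \<open>0\<close> or \<open>1\<close>, then \<open>m\<^sub>0 powr (- r)\<close> would be \<open>1\<close> on
  \<open>{p\<^sub>1 = 1}\<close> and positive elsewhere, so its mean would exceed \<open>\<gamma>\<^sub>1\<close>
  (\<open>harmonic_solution_imp_nondegenerate\<close>). For environments with \<open>p\<^sub>1 \<in> {0, 1}\<close> the claimed
  asymptotics do fail, because all diagonal entries are then equal.

  Part a). The scaled probabilities \<open>\<P>\<^sub>k(Z\<^sub>n = j) / \<gamma>\<^sub>k^n\<close> are non-decreasing in \<open>n\<close>, because the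
  process may spend its first step at \<open>k\<close>, and bounded in \<open>n\<close>, by induction on \<open>j\<close> from
  \<open>\<gamma>\<^sub>j < \<gamma>\<^sub>k\<close>. Their limits form a left eigenvector for \<open>\<gamma>\<^sub>k\<close>, and triangularity with distinct
  diagonal entries makes it the only one with \<open>k\<close>-th entry \<open>1\<close> (\<open>limit_row_eigen\<close>, \<open>eigen_unique\<close>).

  Part b). Let \<open>h(i) = \<E>\<^sub>i[Z\<^sub>1 powr (- s)]\<close>. Multiplying the eigenvector equation by
  \<open>j powr (- s)\<close> and summing over \<open>j < J\<close> gives
  \<open>\<gamma>\<^sub>k (\<Sum>j<J. q\<^sub>j j powr (- s)) \<le> (\<Sum>i<J. q\<^sub>i h(i))\<close>. By the law of large numbers \<open>Z\<^sub>1 / i\<close> is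
  close to \<open>m\<^sub>0\<close> for large \<open>i\<close>, and \<open>Z\<^sub>1 / i \<ge> 1\<close>, so \<open>h(i)\<close> is asymptotically at most
  \<open>\<E>[m\<^sub>0 powr (- s)] i powr (- s)\<close>. For \<open>s > r\<^sub>k\<close> that factor is less than \<open>\<gamma>\<^sub>k\<close>, so all but
  finitely many terms on the right are absorbed by the left side
  (\<open>summable_weighted_limit_row\<close>, \<open>harmonic_sum_limit_row\<close>). The law of large numbers needed is one-sided
  and comes from a Chernoff bound (\<open>offspring_harmonic_le\<close>). Polynomial summability gives radius at
  least \<open>1\<close>; it is exactly \<open>1\<close> since \<open>\<Sum>j. q\<^sub>j \<ge> \<gamma>\<^sub>k^(-n)\<close> for all \<open>n\<close>.

  Parts c) and d). Summation against \<open>t^j\<close> turns the monotone convergence of the scaled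
  probabilities into that of the generating functions. Expanding \<open>\<E>[Q(f\<^sub>0(t))]\<close> in powers of \<open>t\<close>
  identifies the functional equation with the eigenvector equation, coefficient by coefficient
  (\<open>solution_iff_eigen\<close>), so existence and uniqueness follow from the eigenvector statement.
\<close>

section \<open>Sums of independent offspring numbers\<close>

text \<open>
  The probability that \<open>i\<close> independent variables with law \<open>D\<close> add up to \<open>j\<close>. Reading it as a
  coefficient of the \<open>i\<close>-th power of the generating function replaces convolutions of measures by
  Cauchy products.
\<close>

definition offspring_sum_prob :: "nat pmf \<Rightarrow> nat \<Rightarrow> nat \<Rightarrow> real" where
  "offspring_sum_prob D i j = fps_nth (Abs_fps (pmf D) ^ i) j"

lemma offspring_sum_prob_0 [simp]: "offspring_sum_prob D 0 j = (if j = 0 then 1 else 0)"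
  by (simp add: offspring_sum_prob_def)

lemma offspring_sum_prob_Suc:
  "offspring_sum_prob D (Suc i) j = (\<Sum>a\<le>j. pmf D a * offspring_sum_prob D i (j - a))"
  by (simp add: offspring_sum_prob_def fps_mult_nth atLeast0AtMost)

lemma offspring_sum_prob_nonneg: "offspring_sum_prob D i j \<ge> 0"
  by (induction i arbitrary: j) (auto simp: offspring_sum_prob_Suc intro!: sum_nonneg)

lemma pmf_sums_1: "(pmf D) sums 1" for D :: "nat pmf"
proof -
  have "(\<lambda>i. measure (measure_pmf D) {i}) sums measure (measure_pmf D) (\<Union>i. {i})"
    by (rule measure_pmf.finite_measure_UNION) (auto simp: disjoint_family_on_def)
  then show ?thesis by (simp add: pmf.rep_eq measure_pmf.prob_space)
qed

lemma offspring_pgf_sums: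
  fixes t :: real
  assumes "t \<in> {0..1}"
  shows "(\<lambda>j. pmf D j * t ^ j) sums offspring_pgf D t"
proof -
  have "summable (\<lambda>j. pmf D j * t ^ j)"
    by (rule summable_comparison_test'[OF sums_summable[OF pmf_sums_1[of D]]])
       (use assms in \<open>auto intro!: mult_left_le power_le_one\<close>)
  then show ?thesis by (simp add: offspring_pgf_def summable_sums)
qed

lemma offspring_sum_prob_sums:
  assumes t: "t \<in> {0..1}"
  shows "(\<lambda>j. offspring_sum_prob D i j * t ^ j) sums (offspring_pgf D t ^ i)"
proof (induction i)
  case 0
  have "(\<lambda>j. offspring_sum_prob D 0 j * t ^ j) = (\<lambda>j. if j = 0 then 1 else 0)"
    by auto
  then show ?case using sums_single[of 0 "\<lambda>_. 1::real"] by simp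
next
  case (Suc i)
  let ?a = "\<lambda>j. pmf D j * t ^ j" and ?b = "\<lambda>j. offspring_sum_prob D i j * t ^ j"
  have a: "?a sums offspring_pgf D t" by (rule offspring_pgf_sums[OF t])
  have "(\<lambda>k. \<Sum>l\<le>k. ?a l * ?b (k - l)) sums ((\<Sum>k. ?a k) * (\<Sum>k. ?b k))"
    by (rule Cauchy_product_sums)
       (use t a Suc.IH in \<open>auto simp: abs_mult offspring_sum_prob_nonneg sums_iff\<close>)
  also have "(\<Sum>k. ?a k) = offspring_pgf D t" using a by (simp add: sums_iff)
  also have "(\<Sum>k. ?b k) = offspring_pgf D t ^ i" using Suc.IH by (simp add: sums_iff)
  also have "(\<lambda>k. \<Sum>l\<le>k. ?a l * ?b (k - l)) = (\<lambda>k. offspring_sum_prob D (Suc i) k * t ^ k)"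
  proof
    fix k
    have eq: "?a l * ?b (k - l) = pmf D l * offspring_sum_prob D i (k - l) * t ^ k" if "l \<le> k" for l
      using that power_add[of t l "k - l"] by simp
    show "(\<Sum>l\<le>k. ?a l * ?b (k - l)) = offspring_sum_prob D (Suc i) k * t ^ k"
      unfolding offspring_sum_prob_Suc sum_distrib_right
      by (rule sum.cong[OF refl], rule eq) simp
  qed
  finally show ?case by simp
qed

lemma offspring_pgf_nonneg: "0 \<le> t \<Longrightarrow> t \<le> 1 \<Longrightarrow> offspring_pgf D t \<ge> 0"
  by (rule sums_le[OF _ sums_zero offspring_pgf_sums]) auto

lemma offspring_pgf_1: "offspring_pgf D 1 = 1"
  using offspring_pgf_sums[of 1 D] pmf_sums_1[of D] by (simp add: sums_iff)

lemma offspring_sum_prob_sums_1: "offspring_sum_prob D i sums 1"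
  using offspring_sum_prob_sums[of 1 D i] by (simp add: offspring_pgf_1)

lemma offspring_sum_prob_le_1: "offspring_sum_prob D i j \<le> 1"
  using sum_le_suminf[OF sums_summable[OF offspring_sum_prob_sums_1[of D i]], of "{j}"]
    offspring_sum_prob_sums_1[of D i]
  by (auto simp: sums_iff offspring_sum_prob_nonneg)

lemma offspring_sum_prob_eq_0:
  assumes "pmf D 0 = 0" "j < i"
  shows "offspring_sum_prob D i j = 0"
  using assms(2)
proof (induction i arbitrary: j)
  case (Suc i)
  have "pmf D a * offspring_sum_prob D i (j - a) = 0" if "a \<le> j" for a
    using that Suc assms(1) by (cases "a = 0") auto
  then show ?case unfolding offspring_sum_prob_Suc by (intro sum.neutral) auto
qed simp

text \<open>
  Every one of the \<open>i\<close> summands is at least \<open>1\<close>, so the sum equals \<open>i\<close> only if all of them are \<open>1\<close>.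
\<close>

lemma offspring_sum_prob_diag:
  assumes "pmf D 0 = 0"
  shows "offspring_sum_prob D i i = pmf D 1 ^ i"
proof (induction i)
  case (Suc i)
  have *: "pmf D a * offspring_sum_prob D i (Suc i - a) = 0" if "a \<le> Suc i" "a \<noteq> 1" for a
    using that assms by (cases "a = 0") (auto intro!: offspring_sum_prob_eq_0)
  have "(\<Sum>a\<le>Suc i. pmf D a * offspring_sum_prob D i (Suc i - a))
      = (\<Sum>a\<in>{1}. pmf D a * offspring_sum_prob D i (Suc i - a))"
    by (rule sum.mono_neutral_right) (use * in auto)
  then show ?case using Suc by (simp add: offspring_sum_prob_Suc del: sum.atMost_Suc)
qed simp

lemma offspring_pgf_le:
  assumes "pmf D 0 = 0" "0 \<le> t" "t \<le> 1"
  shows "offspring_pgf D t \<le> t"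
proof (rule sums_le)
  show "(\<lambda>j. pmf D j * t ^ j) sums offspring_pgf D t" by (rule offspring_pgf_sums) (use assms in auto)
  show "(\<lambda>j. pmf D j * t) sums t" using sums_mult2[OF pmf_sums_1[of D], of t] by simp
  show "pmf D j * t ^ j \<le> pmf D j * t" for j
    by (cases j) (use assms in \<open>auto intro!: mult_left_mono mult_left_le power_le_one\<close>)
qed

lemma offspring_mean_ge_1:
  assumes "pmf D 0 = 0" "summable (\<lambda>i. real i * pmf D i)"
  shows "offspring_mean D \<ge> 1"
proof (rule sums_le)
  show "pmf D sums 1" by (rule pmf_sums_1)
  show "(\<lambda>i. real i * pmf D i) sums offspring_mean D"
    using assms(2) by (simp add: offspring_mean_def summable_sums)
  show "pmf D j \<le> real j * pmf D j" for j
    using assms(1) by (cases j) (auto simp: algebra_simps)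
qed

lemma offspring_mean_eq_1:
  assumes "pmf D 1 = 1"
  shows "offspring_mean D = 1"
proof -
  have "pmf D j = 0" if "j \<noteq> 1" for j
    using sum_le_suminf[OF sums_summable[OF pmf_sums_1[of D]], of "{j, 1}"] pmf_sums_1[of D]
      pmf_nonneg[of D j] that assms
    by (auto simp: sums_iff)
  then have "(\<lambda>i. real i * pmf D i) = (\<lambda>i. if i = 1 then 1 else 0)"
    using assms by auto
  then show ?thesis
    using sums_single[of 1 "\<lambda>_. 1::real"] by (simp add: offspring_mean_def sums_iff)
qed

section \<open>Harmonic moments of offspring sums\<close>

text \<open>
  The function \<open>\<eta> \<mapsto> exp (\<eta> b) f (exp (- \<eta>))\<close> has value \<open>1\<close> and slope \<open>b - m < 0\<close> at \<open>0\<close>. To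
  differentiate a finite sum only, the mass above a level \<open>L\<close> is moved to \<open>0\<close>, which increases
  the generating function; \<open>L\<close> is so large that the truncated mean still exceeds \<open>b\<close>.
\<close>

lemma exp_tilted_pgf_less_1:
  assumes b: "b < offspring_mean D" and sm: "summable (\<lambda>i. real i * pmf D i)"
  shows "\<exists>\<eta>>0. exp (\<eta> * b) * offspring_pgf D (exp (- \<eta>)) < 1"
proof -
  have "(\<lambda>L. \<Sum>j<L. real j * pmf D j) \<longlonglongrightarrow> offspring_mean D"
    using sm by (simp add: offspring_mean_def summable_LIMSEQ)
  then have "eventually (\<lambda>L. b < (\<Sum>j<L. real j * pmf D j)) sequentially"
    by (rule order_tendstoD) fact
  then obtain L where L: "b < (\<Sum>j<L. real j * pmf D j)"
    by (auto simp: eventually_sequentially)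
  let ?R = "1 - (\<Sum>j<L. pmf D j)"
  let ?g = "\<lambda>\<eta>. exp (\<eta> * b) * ((\<Sum>j<L. pmf D j * exp (- \<eta> * real j)) + ?R)"
  have "(?g has_real_derivative (b - (\<Sum>j<L. real j * pmf D j))) (at 0)"
    by (auto intro!: derivative_eq_intros simp: sum_negf mult.commute)
  then have "\<exists>d>0. \<forall>h>0. h < d \<longrightarrow> ?g 0 > ?g (0 + h)"
    by (rule DERIV_neg_dec_right) (use L in simp)
  then obtain d where d: "d > 0" "\<And>h. 0 < h \<Longrightarrow> h < d \<Longrightarrow> ?g h < ?g 0" by auto
  define \<eta> where "\<eta> = d / 2"
  have \<eta>: "0 < \<eta>" "\<eta> < d" using d by (auto simp: \<eta>_def)
  have "offspring_pgf D (exp (- \<eta>)) \<le> (\<Sum>j<L. pmf D j * exp (- \<eta> * real j)) + ?R"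
  proof -
    have eq: "exp (- \<eta>) ^ j = exp (- \<eta> * real j)" for j
      by (simp add: exp_of_nat_mult[symmetric] mult.commute)
    have s: "(\<lambda>j. pmf D j * exp (- \<eta>) ^ j) sums offspring_pgf D (exp (- \<eta>))"
      by (rule offspring_pgf_sums) (use \<eta> in auto)
    have "(\<lambda>j. pmf D (j + L) * exp (- \<eta>) ^ (j + L)) sums
        (offspring_pgf D (exp (- \<eta>)) - (\<Sum>j<L. pmf D j * exp (- \<eta>) ^ j))"
      using sums_split_initial_segment[OF s, of L] by simp
    moreover have "(\<lambda>j. pmf D (j + L)) sums ?R"
      using sums_split_initial_segment[OF pmf_sums_1[of D], of L] by simp
    ultimately have "offspring_pgf D (exp (- \<eta>)) - (\<Sum>j<L. pmf D j * exp (- \<eta>) ^ j) \<le> ?R"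
      by (rule sums_le[rotated]) (use \<eta> in \<open>auto intro!: mult_left_le power_le_one\<close>)
    then show ?thesis by (simp add: eq)
  qed
  then have "exp (\<eta> * b) * offspring_pgf D (exp (- \<eta>)) \<le> ?g \<eta>"
    by (intro mult_left_mono) auto
  also have "\<dots> < ?g 0" using d \<eta> by auto
  also have "?g 0 = 1" by simp
  finally show ?thesis using \<eta> by blast
qed

text \<open>
  The moment \<open>\<E>[(S\<^sub>i / i) powr (- s)]\<close> of a sum \<open>S\<^sub>i\<close> of \<open>i\<close> independent variables with law \<open>D\<close>.
\<close>

definition offspring_harmonic :: "nat pmf \<Rightarrow> real \<Rightarrow> nat \<Rightarrow> real" where
  "offspring_harmonic D s i = (\<Sum>j. offspring_sum_prob D i j * (real j / real i) powr (- s))"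

lemma summable_offspring_harmonic:
  assumes "pmf D 0 = 0" "s > 0" "i \<ge> 1"
  shows "summable (\<lambda>j. offspring_sum_prob D i j * (real j / real i) powr (- s))" (is "summable ?h")
    and "offspring_harmonic D s i \<le> 1"
    and "offspring_harmonic D s i \<ge> 0"
proof -
  have le: "?h j \<le> offspring_sum_prob D i j" for j
  proof (cases "j < i")
    case False
    then have "(real j / real i) powr (- s) \<le> 1"
      using assms by (auto simp: powr_minus intro!: inverse_le_1_iff[THEN iffD2] ge_one_powr_ge_zero)
    then show ?thesis by (intro mult_left_le) (auto simp: offspring_sum_prob_nonneg)
  qed (use assms offspring_sum_prob_eq_0 in auto)
  have nn: "?h j \<ge> 0" for j by (simp add: offspring_sum_prob_nonneg)
  show sm: "summable ?h"
    by (rule summable_comparison_test'[OF sums_summable[OF offspring_sum_prob_sums_1[of D i]]])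
       (use le nn in auto)
  show "offspring_harmonic D s i \<le> 1"
    unfolding offspring_harmonic_def
    by (rule sums_le[OF _ summable_sums[OF sm] offspring_sum_prob_sums_1[of D i]]) (use le in auto)
  show "offspring_harmonic D s i \<ge> 0"
    unfolding offspring_harmonic_def by (rule suminf_nonneg[OF sm nn])
qed

text \<open>
  Either \<open>S\<^sub>i \<ge> b i\<close>, and then \<open>(S\<^sub>i / i) powr (- s) \<le> b powr (- s)\<close>; or \<open>S\<^sub>i < b i\<close>, where
  \<open>(S\<^sub>i / i) powr (- s) \<le> 1\<close> because \<open>S\<^sub>i \<ge> i\<close>, and \<open>1\<close> is at most \<open>exp (\<eta> (b i - S\<^sub>i))\<close>, whose mean
  is the second term.
\<close>

lemma offspring_harmonic_le:
  assumes D: "pmf D 0 = 0" and s: "s > 0" and i: "i \<ge> 1" and b: "b > 0" and \<eta>: "\<eta> > 0"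
  shows "offspring_harmonic D s i \<le> b powr (- s) + (exp (\<eta> * b) * offspring_pgf D (exp (- \<eta>))) ^ i"
  unfolding offspring_harmonic_def
proof (rule sums_le[OF _ summable_sums[OF summable_offspring_harmonic(1)[OF D s i]]])
  let ?c = "offspring_sum_prob D i"
  have "(\<lambda>j. ?c j * exp (- \<eta>) ^ j) sums (offspring_pgf D (exp (- \<eta>)) ^ i)"
    by (rule offspring_sum_prob_sums) (use \<eta> in auto)
  then have "(\<lambda>j. b powr (- s) * ?c j + exp (\<eta> * b) ^ i * (?c j * exp (- \<eta>) ^ j)) sums
     (b powr (- s) * 1 + exp (\<eta> * b) ^ i * (offspring_pgf D (exp (- \<eta>)) ^ i))"
    by (intro sums_add sums_mult offspring_sum_prob_sums_1)
  then show "(\<lambda>j. b powr (- s) * ?c j + exp (\<eta> * b) ^ i * (?c j * exp (- \<eta>) ^ j)) sums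
     (b powr (- s) + (exp (\<eta> * b) * offspring_pgf D (exp (- \<eta>))) ^ i)"
    by (simp add: power_mult_distrib)
  fix j
  have e: "exp (\<eta> * b) ^ i * exp (- \<eta>) ^ j = exp (\<eta> * (b * real i - real j))"
    by (simp add: exp_of_nat_mult[symmetric] exp_add[symmetric] algebra_simps)
  have "?c j * (real j / real i) powr (- s) \<le> ?c j * (b powr (- s) + exp (\<eta> * (b * real i - real j)))"
  proof (cases "j < i")
    case False
    have "(real j / real i) powr (- s) \<le> b powr (- s) + exp (\<eta> * (b * real i - real j))"
    proof (cases "b \<le> real j / real i")
      case True
      then have "(real j / real i) powr (- s) \<le> b powr (- s)"
        using b s by (intro powr_mono2') auto
      then show ?thesis by (smt (verit) exp_gt_zero)
    next
      case F: False
      have "(real j / real i) powr (- s) \<le> 1"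
        using False s i by (auto simp: powr_minus intro!: inverse_le_1_iff[THEN iffD2] ge_one_powr_ge_zero)
      also have "1 \<le> exp (\<eta> * (b * real i - real j))"
        using F \<eta> i by (auto simp: field_simps)
      finally show ?thesis by (smt (verit) powr_ge_zero)
    qed
    then show ?thesis by (intro mult_left_mono) (auto simp: offspring_sum_prob_nonneg)
  qed (use D offspring_sum_prob_eq_0 in auto)
  then show "?c j * (real j / real i) powr (- s)
      \<le> b powr (- s) * ?c j + exp (\<eta> * b) ^ i * (?c j * exp (- \<eta>) ^ j)"
    using e by (simp add: algebra_simps)
qed

text \<open>
  The one-sided law of large numbers: the upper limit of the harmonic moments is at most
  \<open>m powr (- s)\<close>, as one sees by letting \<open>b\<close> increase to \<open>m\<close> in the preceding bound. The maximum turns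
  this upper bound into a convergent sequence, ready for dominated convergence.
\<close>

lemma offspring_harmonic_tendsto:
  assumes D: "pmf D 0 = 0" and sm: "summable (\<lambda>i. real i * pmf D i)" and s: "s > 0"
  shows "(\<lambda>i. max (offspring_harmonic D s i) (offspring_mean D powr (- s)))
           \<longlonglongrightarrow> offspring_mean D powr (- s)"
proof (rule order_tendstoI)
  let ?m = "offspring_mean D"
  have m: "?m \<ge> 1" using D sm by (rule offspring_mean_ge_1)
  fix a assume a: "?m powr (- s) < a"
  have "((\<lambda>b. b powr (- s)) \<longlongrightarrow> ?m powr (- s)) (at_left ?m)"
    using m by (intro tendsto_intros) auto
  then have "eventually (\<lambda>b. b powr (- s) < a) (at_left ?m)"
    using a by (rule order_tendstoD)
  moreover have "eventually (\<lambda>b. b \<in> {0<..<?m}) (at_left ?m)"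
    using m by (intro eventually_at_leftI[of 0]) auto
  ultimately have "eventually (\<lambda>b. b powr (- s) < a \<and> b \<in> {0<..<?m}) (at_left ?m)"
    by (rule eventually_conj)
  then obtain b where b: "b powr (- s) < a" "0 < b" "b < ?m"
    by (metis (no_types, lifting) eventually_happens' trivial_limit_at_left_real greaterThanLessThan_iff)
  obtain \<eta> where \<eta>: "\<eta> > 0" "exp (\<eta> * b) * offspring_pgf D (exp (- \<eta>)) < 1" (is "?x < 1")
    using exp_tilted_pgf_less_1[OF b(3) sm] by blast
  have "?x \<ge> 0" using \<eta> by (intro mult_nonneg_nonneg offspring_pgf_nonneg) auto
  then have "(\<lambda>i. b powr (- s) + ?x ^ i) \<longlonglongrightarrow> b powr (- s) + 0"
    using \<eta> by (intro tendsto_intros LIMSEQ_power_zero) auto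
  then have "eventually (\<lambda>i. b powr (- s) + ?x ^ i < a) sequentially"
    using b by (intro order_tendstoD) auto
  then show "eventually (\<lambda>i. max (offspring_harmonic D s i) (?m powr (- s)) < a) sequentially"
    using eventually_ge_at_top[of 1]
    by eventually_elim (use offspring_harmonic_le[OF D s _ b(2) \<eta>(1)] a in fastforce)
qed (auto intro: always_eventually)

section \<open>Triangular kernels\<close>

text \<open>
  Powers of a non-negative upper triangular matrix, seen from a fixed row \<open>k\<close> whose diagonal entry
  dominates all later ones.
\<close>

locale triangular_kernel =
  fixes P :: "nat \<Rightarrow> nat \<Rightarrow> real" and k :: nat
  assumes P_nonneg: "P i j \<ge> 0"
    and P_upper: "j < i \<Longrightarrow> P i j = 0"
    and P_diag_pos: "P k k > 0"
    and P_diag_less: "k < j \<Longrightarrow> P j j < P k k"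
begin

fun row :: "nat \<Rightarrow> nat \<Rightarrow> real" where
  "row 0 j = (if j = k then 1 else 0)"
| "row (Suc n) j = (\<Sum>i\<le>j. row n i * P i j)"

lemma row_nonneg: "row n j \<ge> 0"
  by (induction n arbitrary: j) (auto simp: P_nonneg intro!: sum_nonneg)

lemma row_less: "j < k \<Longrightarrow> row n j = 0"
  by (induction n arbitrary: j) auto

definition scaled_row :: "nat \<Rightarrow> nat \<Rightarrow> real" where
  "scaled_row n j = row n j / P k k ^ n"

lemma scaled_row_nonneg: "scaled_row n j \<ge> 0"
  using P_diag_pos by (simp add: scaled_row_def row_nonneg)

lemma scaled_row_Suc: "P k k * scaled_row (Suc n) j = (\<Sum>i\<le>j. scaled_row n i * P i j)"
  using P_diag_pos by (simp add: scaled_row_def sum_divide_distrib field_simps sum_distrib_right sum_distrib_left)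

text \<open>
  A path may spend its first step at \<open>k\<close>. The induction on \<open>n\<close> peels off the last step, as the
  recursion does.
\<close>

lemma row_Suc_ge: "row (Suc n) j \<ge> P k k * row n j"
proof (induction n arbitrary: j)
  case 0
  have "row 0 k * P k j \<le> row (Suc 0) j" if "j = k"
    unfolding row.simps(2)[of 0 j] by (rule member_le_sum) (use that in \<open>auto simp: P_nonneg\<close>)
  then show ?case by (cases "j = k") (auto simp: P_nonneg intro!: sum_nonneg)
next
  case (Suc n)
  have "P k k * row (Suc n) j = (\<Sum>i\<le>j. P k k * row n i * P i j)"
    by (simp add: sum_distrib_left mult_ac)
  also have "\<dots> \<le> (\<Sum>i\<le>j. row (Suc n) i * P i j)"
    using Suc.IH by (intro sum_mono mult_right_mono) (auto simp: P_nonneg)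
  finally show ?case by simp
qed

lemma scaled_row_incseq: "incseq (\<lambda>n. scaled_row n j)"
  using P_diag_pos row_Suc_ge
  by (intro incseq_SucI) (auto simp: scaled_row_def field_simps)

lemma scaled_row_at_k: "scaled_row n k = 1"
proof (induction n)
  case (Suc n)
  have "P k k * scaled_row (Suc n) k = (\<Sum>i\<in>{k}. scaled_row n i * P i k)"
    unfolding scaled_row_Suc by (rule sum.mono_neutral_right) (auto simp: scaled_row_def row_less)
  then show ?case using Suc P_diag_pos by simp
qed (simp add: scaled_row_def)

text \<open>
  For \<open>j > k\<close> the column \<open>j\<close> satisfies \<open>x\<^sub>n\<^sub>+\<^sub>1 \<le> C + \<theta> x\<^sub>n\<close> with \<open>\<theta> = P j j / P k k < 1\<close>, where \<open>C\<close> collects the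
  bounds for the smaller columns; hence \<open>x\<^sub>n\<close> never exceeds the fixed point \<open>C / (1 - \<theta>)\<close>.
\<close>

lemma scaled_row_bounded: "\<exists>B. \<forall>n. scaled_row n j \<le> B"
proof (induction j rule: less_induct)
  case (less j)
  consider "j < k" | "j = k" | "k < j" by linarith
  then show ?case
  proof cases
    case 1
    then show ?thesis by (auto simp: scaled_row_def row_less)
  next
    case 2
    then show ?thesis by (auto simp: scaled_row_at_k)
  next
    case 3
    obtain B where B: "\<And>i n. i < j \<Longrightarrow> scaled_row n i \<le> B i" using less by metis
    define C where "C = (\<Sum>i<j. B i * P i j) / P k k"
    define \<theta> where "\<theta> = P j j / P k k"
    have \<theta>: "0 \<le> \<theta>" "\<theta> < 1" using P_diag_less[OF 3] P_diag_pos P_nonneg by (auto simp: \<theta>_def)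
    have "0 \<le> B i" if "i < j" for i using B[OF that, of 0] scaled_row_nonneg[of 0 i] by linarith
    then have C: "C \<ge> 0" using P_diag_pos by (auto simp: C_def P_nonneg intro!: divide_nonneg_nonneg sum_nonneg)
    have step: "scaled_row (Suc n) j \<le> C + \<theta> * scaled_row n j" for n
    proof -
      have "P k k * scaled_row (Suc n) j = (\<Sum>i<j. scaled_row n i * P i j) + scaled_row n j * P j j"
        unfolding scaled_row_Suc by (simp flip: lessThan_Suc_atMost)
      also have "(\<Sum>i<j. scaled_row n i * P i j) \<le> (\<Sum>i<j. B i * P i j)"
        using B by (intro sum_mono mult_right_mono) (auto simp: P_nonneg)
      finally show ?thesis using P_diag_pos by (simp add: C_def \<theta>_def field_simps)
    qed
    have "scaled_row n j \<le> C / (1 - \<theta>)" for n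
    proof (induction n)
      case 0
      then show ?case using 3 C \<theta> by (simp add: scaled_row_def)
    next
      case (Suc n)
      have "scaled_row (Suc n) j \<le> C + \<theta> * (C / (1 - \<theta>))"
        using step[of n] mult_left_mono[OF Suc \<theta>(1)] by linarith
      also have "\<dots> = C / (1 - \<theta>)" using \<theta> by (simp add: field_simps)
      finally show ?case .
    qed
    then show ?thesis by blast
  qed
qed

definition limit_row :: "nat \<Rightarrow> real" where "limit_row j = lim (\<lambda>n. scaled_row n j)"

lemma scaled_row_tendsto: "(\<lambda>n. scaled_row n j) \<longlonglongrightarrow> limit_row j"
proof -
  obtain B where "\<forall>n. scaled_row n j \<le> B" using scaled_row_bounded by blast
  then have "convergent (\<lambda>n. scaled_row n j)"
    using scaled_row_incseq[of j] by (metis convergentI incseq_convergent)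
  then show ?thesis by (simp add: limit_row_def convergent_LIMSEQ_iff)
qed

lemma scaled_row_le_limit_row: "scaled_row n j \<le> limit_row j"
  using incseq_le[OF scaled_row_incseq scaled_row_tendsto] .

lemma limit_row_nonneg: "limit_row j \<ge> 0"
  using scaled_row_le_limit_row[of 0 j] scaled_row_nonneg[of 0 j] by linarith

lemma limit_row_less: "j < k \<Longrightarrow> limit_row j = 0"
  using scaled_row_tendsto[of j] by (simp add: scaled_row_def row_less LIMSEQ_const_iff)

lemma limit_row_at_k: "limit_row k = 1"
  using scaled_row_tendsto[of k] by (simp add: scaled_row_at_k LIMSEQ_const_iff)

lemma limit_row_pos_iff: "limit_row j > 0 \<longleftrightarrow> (\<exists>n. row n j > 0)"
proof
  assume "\<exists>n. row n j > 0"
  then obtain n where "row n j > 0" ..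
  then have "scaled_row n j > 0" using P_diag_pos by (simp add: scaled_row_def)
  then show "limit_row j > 0" using scaled_row_le_limit_row[of n j] by linarith
next
  assume limit_row: "limit_row j > 0"
  show "\<exists>n. row n j > 0"
  proof (rule ccontr)
    assume "\<not> ?thesis"
    then have "scaled_row n j = 0" for n using row_nonneg[of n j] by (auto simp: scaled_row_def not_less intro: antisym)
    then show False using limit_row scaled_row_tendsto[of j] by (simp add: LIMSEQ_const_iff)
  qed
qed

lemma limit_row_eigen: "P k k * limit_row j = (\<Sum>i\<le>j. limit_row i * P i j)"
proof (rule LIMSEQ_unique)
  show "(\<lambda>n. P k k * scaled_row (Suc n) j) \<longlonglongrightarrow> P k k * limit_row j"
    by (intro tendsto_mult_left LIMSEQ_Suc scaled_row_tendsto)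
  show "(\<lambda>n. P k k * scaled_row (Suc n) j) \<longlonglongrightarrow> (\<Sum>i\<le>j. limit_row i * P i j)"
    unfolding scaled_row_Suc by (intro tendsto_intros scaled_row_tendsto)
qed

text \<open>
  Column \<open>j\<close> of the equation determines the entry \<open>j\<close> from the earlier ones unless
  \<open>P j j = P k k\<close>, which happens only at \<open>j = k\<close>, where the entry is prescribed.
\<close>

lemma eigen_unique:
  assumes a: "\<And>j. P k k * a j = (\<Sum>i\<le>j. a i * P i j)" and ak: "a k = 1"
    and ne: "\<And>j. j < k \<Longrightarrow> P j j \<noteq> P k k"
  shows "a = limit_row"
proof
  fix j show "a j = limit_row j"
  proof (induction j rule: less_induct)
    case (less j)
    show ?case
    proof (cases "j = k")
      case False
      have split: "(\<Sum>i\<le>j. b i * P i j) = (\<Sum>i<j. b i * P i j) + b j * P j j" for b :: "nat \<Rightarrow> real"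
        by (simp flip: lessThan_Suc_atMost)
      have "P j j \<noteq> P k k"
        using False ne P_diag_less[of j] by (cases j k rule: linorder_cases) auto
      moreover have "(P k k - P j j) * a j = (P k k - P j j) * limit_row j"
        using a[of j] limit_row_eigen[of j] less unfolding split by (simp add: algebra_simps)
      ultimately show ?thesis by simp
    qed (simp add: ak limit_row_at_k)
  qed
qed

text \<open>
  A drift criterion for the left eigenvector. Partial sums \<open>T = (\<Sum>j<J. limit_row j * w j)\<close> satisfy
  \<open>P k k * T \<le> C + \<theta> * P k k * T\<close>, where \<open>C\<close> bounds the contribution of the rows below \<open>K\<close>; working
  with finite \<open>J\<close> makes \<open>T\<close> finite from the start, so that it can be moved to the left side.
\<close>

lemma summable_weighted_limit_row:
  assumes w: "\<And>j. w j \<ge> 0"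
    and bound: "\<And>i J. (\<Sum>j<J. P i j * w j) \<le> h i"
    and \<theta>: "0 \<le> \<theta>" "\<theta> < 1" and drift: "\<And>i. i \<ge> K \<Longrightarrow> h i \<le> \<theta> * P k k * w i"
  shows "summable (\<lambda>j. limit_row j * w j)"
proof (rule summableI_nonneg_bounded)
  fix J
  define T where "T = (\<Sum>j<J. limit_row j * w j)"
  define C where "C = (\<Sum>i<K. limit_row i * h i)"
  have h: "h i \<ge> 0" for i using bound[where J = 0] by simp
  have T0: "T \<ge> 0" by (auto simp: T_def limit_row_nonneg w intro!: sum_nonneg)
  have "P k k * T = (\<Sum>j<J. (\<Sum>i\<le>j. limit_row i * P i j) * w j)"
    unfolding limit_row_eigen[symmetric] by (simp add: T_def sum_distrib_left mult_ac)
  also have "\<dots> = (\<Sum>j<J. (\<Sum>i<J. limit_row i * P i j) * w j)"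
    by (intro sum.cong refl arg_cong2[where f = "(*)"] sum.mono_neutral_left) (auto simp: P_upper)
  also have "\<dots> = (\<Sum>i<J. limit_row i * (\<Sum>j<J. P i j * w j))"
    by (simp add: sum_distrib_right sum_distrib_left mult.assoc) (rule sum.swap)
  also have "\<dots> \<le> (\<Sum>i<J. limit_row i * h i)"
    by (intro sum_mono mult_left_mono bound limit_row_nonneg)
  also have "\<dots> \<le> (\<Sum>i<J. (if i < K then limit_row i * h i else 0) + limit_row i * (\<theta> * P k k * w i))"
    using drift \<theta>(1) P_diag_pos w limit_row_nonneg
    by (intro sum_mono) (auto simp: not_less intro!: mult_left_mono)
  also have "\<dots> = (\<Sum>i<J. if i < K then limit_row i * h i else 0) + \<theta> * P k k * T"
    by (simp add: sum.distrib T_def sum_distrib_left mult_ac)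
  also have "(\<Sum>i<J. if i < K then limit_row i * h i else 0) = (\<Sum>i\<in>{..<J} \<inter> {..<K}. limit_row i * h i)"
    by (simp add: sum.inter_restrict)
  also have "\<dots> \<le> C"
    unfolding C_def by (rule sum_mono2) (auto simp: h limit_row_nonneg)
  finally have "(1 - \<theta>) * P k k * T \<le> C" by (simp add: algebra_simps)
  then show "(\<Sum>j<J. limit_row j * w j) \<le> C / ((1 - \<theta>) * P k k)"
    using \<theta> P_diag_pos by (simp add: T_def field_simps)
qed (use w limit_row_nonneg in auto)

end

section \<open>Power series and triangular double series\<close>

text \<open>
  The first coefficient in which the series differ would be the limit at \<open>0\<close> of their difference
  divided by a power of \<open>t\<close>. Only values on one side of \<open>0\<close> are given, which suffices for the limit.
\<close>

lemma powser_eq_imp_coeff_eq: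
  fixes a b :: "nat \<Rightarrow> real"
  assumes sm: "\<And>t. 0 \<le> t \<Longrightarrow> t < 1 \<Longrightarrow> summable (\<lambda>j. a j * t ^ j)"
      "\<And>t. 0 \<le> t \<Longrightarrow> t < 1 \<Longrightarrow> summable (\<lambda>j. b j * t ^ j)"
    and eq: "\<And>t. 0 \<le> t \<Longrightarrow> t < 1 \<Longrightarrow> (\<Sum>j. a j * t ^ j) = (\<Sum>j. b j * t ^ j)"
  shows "a = b"
proof
  fix n show "a n = b n"
  proof (induction n rule: less_induct)
    case (less n)
    define c where "c j = a (j + n) - b (j + n)" for j
    have z: "(\<lambda>j. c j * t ^ j) sums 0" if t: "0 < t" "t < 1" for t
    proof -
      have "(\<lambda>j. a j * t ^ j - b j * t ^ j) sums 0"
        using sums_diff[OF summable_sums[OF sm(1)[of t]] summable_sums[OF sm(2)[of t]]] eq[of t] t by simp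
      from sums_split_initial_segment[OF this, of n]
      have "(\<lambda>j. t ^ n * (c j * t ^ j)) sums (t ^ n * 0)"
        using less by (simp add: c_def algebra_simps power_add)
      then show ?thesis using t by (subst (asm) sums_mult_iff) auto
    qed
    have sc: "summable (\<lambda>j. c j * t ^ j)" if t: "norm t < 1" for t
    proof -
      obtain s where s: "norm t < s" "s < 1" using dense[OF t] by blast
      then have "summable (\<lambda>j. c j * s ^ j)"
        using z[of s] s norm_ge_zero[of t] by (auto simp: sums_iff simp del: norm_ge_zero real_norm_def)
      then show ?thesis by (rule powser_inside[OF _ ]) (use s in auto)
    qed
    have "((\<lambda>t. \<Sum>j. c j * t ^ j) \<longlongrightarrow> c 0) (at 0)"
      by (rule powser_limit_0[of 1]) (use sc in \<open>auto simp: summable_sums\<close>)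
    then have lim: "((\<lambda>t. \<Sum>j. c j * t ^ j) \<longlongrightarrow> c 0) (at_right 0)"
      by (rule filterlim_mono) (auto simp: at_within_le_nhds at_le)
    moreover have "((\<lambda>t. \<Sum>j. c j * t ^ j) \<longlongrightarrow> 0) (at_right 0)"
      by (rule tendsto_eventually, rule eventually_at_rightI[of _ 1]) (use z in \<open>auto simp: sums_iff\<close>)
    ultimately have "c 0 = 0" by (rule tendsto_unique[rotated]) simp
    then show ?case by (simp add: c_def)
  qed
qed

text \<open>
  Fubini's theorem for an absolutely summable array, the column sums being finite by triangularity.
  Counting measure on the columns turns it into the exchange of a series and an integral.
\<close>

lemma triangular_double_sum:
  fixes g :: "nat \<Rightarrow> nat \<Rightarrow> real"
  assumes upper: "\<And>i j. j < i \<Longrightarrow> g i j = 0"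
    and inner: "\<And>i. summable (\<lambda>j. \<bar>g i j\<bar>)"
    and outer: "summable (\<lambda>i. \<Sum>j. \<bar>g i j\<bar>)"
  shows "(\<lambda>j. \<Sum>i\<le>j. g i j) sums (\<Sum>i. \<Sum>j. g i j)"
proof -
  let ?C = "count_space (UNIV :: nat set)"
  have int: "integrable ?C (g i)" for i
    using inner by (simp add: integrable_count_space_nat_iff)
  have col: "(\<lambda>i. g i j) sums (\<Sum>i\<le>j. g i j)" for j
    by (rule sums_finite) (auto simp: upper not_le)
  have coln: "summable (\<lambda>i. norm (g i j))" for j
    by (rule summable_finite[of "{..j}"]) (auto simp: upper not_le)
  have eq: "(\<integral>j. \<bar>g i j\<bar> \<partial>?C) = (\<Sum>j. \<bar>g i j\<bar>)" for i
    using inner by (intro integral_count_space_nat) (simp add: integrable_count_space_nat_iff)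
  have eq': "(\<integral>j. g i j \<partial>?C) = (\<Sum>j. g i j)" for i
    by (intro integral_count_space_nat int)
  have S: "(\<Sum>i. g i j) = (\<Sum>i\<le>j. g i j)" for j using col by (simp add: sums_iff)
  have AE: "AE j in ?C. summable (\<lambda>i. norm (g i j))" using coln by simp
  have sn: "summable (\<lambda>i. \<integral>j. norm (g i j) \<partial>?C)" using outer by (simp add: eq)
  have I: "integrable ?C (\<lambda>j. \<Sum>i\<le>j. g i j)"
    using integrable_suminf[OF int AE sn] by (simp add: S)
  have "(\<integral>j. (\<Sum>i\<le>j. g i j) \<partial>?C) = (\<Sum>i. \<Sum>j. g i j)"
    using integral_suminf[OF int AE sn] by (simp add: S eq')
  then show "(\<lambda>j. \<Sum>i\<le>j. g i j) sums (\<Sum>i. \<Sum>j. g i j)"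
    using sums_integral_count_space_nat[OF I] by simp
qed

section \<open>The law of the process\<close>

context branching_random_environment
begin

lemma env_measurable [measurable]: "\<xi> n \<in> measurable M E"
  using env_indep by (simp add: indep_vars_def)

lemma pmf_env_measurable [measurable]: "(\<lambda>\<omega>. pmf (p (\<xi> n \<omega>)) i) \<in> borel_measurable M"
  using measurable_compose[OF env_measurable p_measurable] .

lemma offspring_sum_prob_measurable: "(\<lambda>e. offspring_sum_prob (p e) i j) \<in> borel_measurable E"
proof (induction i arbitrary: j)
  case (Suc i)
  show ?case unfolding offspring_sum_prob_Suc
    by (intro borel_measurable_sum borel_measurable_times p_measurable Suc)
qed simp

lemma offspring_sum_prob_env_measurable [measurable]:
  "(\<lambda>\<omega>. offspring_sum_prob (p (\<xi> n \<omega>)) i j) \<in> borel_measurable M"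
  using measurable_compose[OF env_measurable offspring_sum_prob_measurable] .

lemma integral_env_eq:
  fixes g :: "'e \<Rightarrow> real"
  assumes g: "g \<in> borel_measurable E"
  shows "(\<integral>\<omega>. g (\<xi> n \<omega>) \<partial>M) = (\<integral>\<omega>. g (\<xi> 0 \<omega>) \<partial>M)"
proof -
  have "(\<integral>\<omega>. g (\<xi> n \<omega>) \<partial>M) = integral\<^sup>L (distr M E (\<xi> n)) g"
    by (simp add: integral_distr[OF env_measurable g])
  also have "\<dots> = integral\<^sup>L (distr M E (\<xi> 0)) g"
    by (simp only: env_ident[of n])
  also have "\<dots> = (\<integral>\<omega>. g (\<xi> 0 \<omega>) \<partial>M)"
    by (simp add: integral_distr[OF env_measurable g])
  finally show ?thesis .
qed

lemma env_subalgebra: "subalgebra M (env_algebra M E \<xi>)"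
proof -
  have "(\<lambda>\<omega> n. \<xi> n \<omega>) \<in> measurable M (Pi\<^sub>M UNIV (\<lambda>_. E))"
    by (rule measurable_PiM_single') (use measurable_space[OF env_measurable] in auto)
  then have "(\<lambda>\<omega>. \<omega>) \<in> measurable M (env_algebra M E \<xi>)"
    unfolding env_algebra_def by (intro measurable_vimage_algebra2) auto
  from measurable_sets[OF this]
  show ?thesis
    using sets.sets_into_space[of _ "env_algebra M E \<xi>"]
    unfolding subalgebra_def
    by (auto simp: env_algebra_def Int_absorb2)
qed

lemma cylinder_measurable:
  assumes "finite I" "I \<subseteq> UNIV \<times> {1..}"
  shows "{\<omega> \<in> space M. \<forall>(n, i)\<in>I. N n i \<omega> = c n i} \<in> sets M"
proof -
  have "{\<omega> \<in> space M. \<forall>x\<in>I. N (fst x) (snd x) \<omega> = c (fst x) (snd x)} \<in> sets M"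
  proof (rule sets.sets_Collect_finite_All[OF _ assms(1)])
    fix x assume "x \<in> I"
    then have [measurable]: "N (fst x) (snd x) \<in> measurable M (count_space UNIV)"
      using assms(2) by (auto intro!: N_measurable)
    show "{\<omega> \<in> space M. N (fst x) (snd x) \<omega> = c (fst x) (snd x)} \<in> sets M"
      by measurable
  qed
  then show ?thesis by (simp add: case_prod_beta)
qed

text \<open>
  Averaging the conditional product formula over the environment.
\<close>

lemma prob_cylinder:
  assumes I: "finite I" "I \<subseteq> UNIV \<times> {1..}"
  shows "prob {\<omega> \<in> space M. \<forall>(n, i)\<in>I. N n i \<omega> = c n i}
       = (\<integral>\<omega>. (\<Prod>(n, i)\<in>I. pmf (p (\<xi> n \<omega>)) (c n i)) \<partial>M)"
proof -
  interpret sub: finite_measure_subalgebra M "env_algebra M E \<xi>"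
    by unfold_locales (rule env_subalgebra)
  let ?A = "{\<omega> \<in> space M. \<forall>(n, i)\<in>I. N n i \<omega> = c n i}"
  have A: "?A \<in> sets M" by (rule cylinder_measurable[OF I])
  have [measurable]: "(\<lambda>\<omega>. \<Prod>(n, i)\<in>I. pmf (p (\<xi> n \<omega>)) (c n i)) \<in> borel_measurable M"
    unfolding case_prod_beta by measurable
  have "prob ?A = (\<integral>\<omega>. indicator ?A \<omega> \<partial>M)"
    using A by (simp add: sets.sets_into_space Int_absorb2)
  also have "\<dots> = (\<integral>\<omega>. real_cond_exp M (env_algebra M E \<xi>) (indicator ?A) \<omega> \<partial>M)"
    by (intro sub.real_cond_exp_int(2)[symmetric] integrable_real_indicator[OF A])
       (simp add: emeasure_finite less_top[symmetric])
  also have "\<dots> = (\<integral>\<omega>. (\<Prod>(n, i)\<in>I. pmf (p (\<xi> n \<omega>)) (c n i)) \<partial>M)"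
    using offspring[OF I, of c] by (intro integral_cong_AE) auto
  finally show ?thesis .
qed

definition row_cylinder :: "nat \<Rightarrow> nat set \<Rightarrow> (nat \<Rightarrow> nat) \<Rightarrow> 'w set" where
  "row_cylinder n L c = {\<omega> \<in> space M. \<forall>i\<in>L. N n i \<omega> = c i}"

text \<open>
  The empty set is included to make the family closed under intersections: two cylinders with
  conflicting prescriptions are disjoint.
\<close>

definition row_cylinders :: "nat \<Rightarrow> 'w set set" where
  "row_cylinders n = insert {} {row_cylinder n L c | L c. finite L \<and> L \<subseteq> {1..}}"

lemma row_cylinder_eq: "row_cylinder n L c = {\<omega> \<in> space M. \<forall>(m, i)\<in>{n} \<times> L. N m i \<omega> = c i}"
  by (auto simp: row_cylinder_def)

lemma row_cylinder_in_events:
  assumes "finite L" "L \<subseteq> {1..}"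
  shows "row_cylinder n L c \<in> sets M"
  unfolding row_cylinder_eq by (rule cylinder_measurable) (use assms in auto)

lemma prob_row_cylinder:
  assumes "finite L" "L \<subseteq> {1..}"
  shows "prob (row_cylinder n L c) = (\<integral>\<omega>. (\<Prod>i\<in>L. pmf (p (\<xi> n \<omega>)) (c i)) \<partial>M)"
proof -
  have "(\<Prod>(m, i)\<in>{n} \<times> L. pmf (p (\<xi> m \<omega>)) (c i)) = (\<Prod>i\<in>L. pmf (p (\<xi> n \<omega>)) (c i))" for \<omega>
    by (subst prod.Sigma[symmetric]) (use assms in simp_all)
  then show ?thesis
    unfolding row_cylinder_eq using assms by (subst prob_cylinder) auto
qed

lemma row_cylinders_Int_stable: "Int_stable (row_cylinders n)"
proof (rule Int_stableI)
  fix A B assume A: "A \<in> row_cylinders n" and B: "B \<in> row_cylinders n"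
  show "A \<inter> B \<in> row_cylinders n"
  proof (cases "A = {} \<or> B = {}")
    case False
    then obtain L c L' c' where L: "A = row_cylinder n L c" "finite L" "L \<subseteq> {1..}"
      and L': "B = row_cylinder n L' c'" "finite L'" "L' \<subseteq> {1..}"
      using A B unfolding row_cylinders_def by blast
    show ?thesis
    proof (cases "\<forall>i\<in>L \<inter> L'. c i = c' i")
      case True
      then have "A \<inter> B = row_cylinder n (L \<union> L') (\<lambda>i. if i \<in> L then c i else c' i)"
        by (auto simp: L L' row_cylinder_def)
      then show ?thesis using L L' unfolding row_cylinders_def by blast
    next
      case False
      then have "A \<inter> B = {}" by (auto simp: L L' row_cylinder_def)
      then show ?thesis by (simp add: row_cylinders_def)
    qed
  qed (auto simp: row_cylinders_def)
qed

text \<open>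
  The probability of an intersection of cylinders from different rows is the mean of a product, one
  factor for each row; each factor depends on a single environment variable, and these are
  independent.
\<close>

lemma rows_indep: "indep_sets row_cylinders UNIV"
proof (rule indep_setsI)
  show "row_cylinders n \<subseteq> events" for n
    using row_cylinder_in_events by (auto simp: row_cylinders_def)
next
  fix A J assume J: "J \<noteq> {}" "finite J" and A: "\<forall>n\<in>J. A n \<in> row_cylinders n"
  show "prob (\<Inter>n\<in>J. A n) = (\<Prod>n\<in>J. prob (A n))"
  proof (cases "\<exists>n\<in>J. A n = {}")
    case True
    then obtain m where m: "m \<in> J" "A m = {}" by blast
    then have "(\<Inter>n\<in>J. A n) = {}" by blast
    moreover have "(\<Prod>n\<in>J. prob (A n)) = 0"
      by (rule prod_zero[OF J(2)]) (use m in \<open>auto intro!: bexI[of _ m]\<close>)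
    ultimately show ?thesis by simp
  next
    case False
    then have "\<forall>n\<in>J. \<exists>L c. A n = row_cylinder n L c \<and> finite L \<and> L \<subseteq> {1..}"
      using A unfolding row_cylinders_def by blast
    then obtain L c where L: "\<And>n. n \<in> J \<Longrightarrow> A n = row_cylinder n (L n) (c n)"
      "\<And>n. n \<in> J \<Longrightarrow> finite (L n)" "\<And>n. n \<in> J \<Longrightarrow> L n \<subseteq> {1..}"
      by metis
    define h where "h n e = (\<Prod>i\<in>L n. pmf (p e) (c n i))" for n e
    have h: "h n \<in> borel_measurable E" for n
      unfolding h_def by (intro borel_measurable_prod p_measurable)
    have h01: "0 \<le> h n e" "h n e \<le> 1" for n e
      unfolding h_def by (auto intro!: prod_nonneg prod_le_1 pmf_le_1)
    have fin: "finite (Sigma J L)" using J(2) L(2) by (rule finite_SigmaI)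
    have sub: "Sigma J L \<subseteq> UNIV \<times> {1..}" using L(3) by fast
    have "(\<Inter>n\<in>J. A n) = {\<omega> \<in> space M. \<forall>(n, i)\<in>Sigma J L. N n i \<omega> = c n i}"
      using J L(1) by (auto simp: row_cylinder_def)
    then have "prob (\<Inter>n\<in>J. A n) = (\<integral>\<omega>. (\<Prod>(n, i)\<in>Sigma J L. pmf (p (\<xi> n \<omega>)) (c n i)) \<partial>M)"
      using prob_cylinder[OF fin sub, of c] by simp
    also have "\<dots> = (\<integral>\<omega>. (\<Prod>n\<in>J. h n (\<xi> n \<omega>)) \<partial>M)"
      unfolding h_def by (subst prod.Sigma) (use J L(2) in simp_all)
    also have "\<dots> = (\<Prod>n\<in>J. \<integral>\<omega>. h n (\<xi> n \<omega>) \<partial>M)"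
    proof (rule indep_vars_lebesgue_integral)
      show "indep_vars (\<lambda>_. borel) (\<lambda>n \<omega>. h n (\<xi> n \<omega>)) J"
        by (rule indep_vars_compose2[OF indep_vars_subset[OF env_indep]]) (use h in auto)
      show "integrable M (\<lambda>\<omega>. h n (\<xi> n \<omega>))" for n
        by (rule integrable_const_bound[where B = 1])
           (use h01 measurable_compose[OF env_measurable h] in auto)
    qed (rule J)
    also have "\<dots> = (\<Prod>n\<in>J. prob (A n))"
      using L by (intro prod.cong refl) (simp add: prob_row_cylinder h_def)
    finally show ?thesis .
  qed
qed

lemma row_cylinders_sub: "(\<Union>m\<in>S. row_cylinders m) \<subseteq> sets M"
  using rows_indep by (auto simp: indep_sets_def)

text \<open>
  The \<open>\<sigma>\<close>-algebra generated by the offspring rows with index in \<open>S\<close>; for \<open>S = {..<n}\<close> it is the past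
  of \<open>Z\<^sub>n\<close>.
\<close>

definition row_sigma :: "nat set \<Rightarrow> 'w measure" where
  "row_sigma S = sigma (space M) (\<Union>m\<in>S. row_cylinders m)"

lemma space_row_sigma [simp]: "space (row_sigma S) = space M"
  by (simp add: row_sigma_def space_measure_of_conv)

lemma sets_row_sigma: "sets (row_sigma S) = sigma_sets (space M) (\<Union>m\<in>S. row_cylinders m)"
  unfolding row_sigma_def
  by (rule sets_measure_of) (use row_cylinders_sub[of S] sets.space_closed in blast)

lemma row_sigma_mono: "S \<subseteq> T \<Longrightarrow> sets (row_sigma S) \<subseteq> sets (row_sigma T)"
  unfolding sets_row_sigma by (rule sigma_sets_mono') blast

lemma row_sigma_sub: "sets (row_sigma S) \<subseteq> sets M"
  unfolding sets_row_sigma by (rule sets.sigma_sets_subset[OF row_cylinders_sub])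

lemma N_measurable_row_cylinders:
  assumes "n \<in> S" "i \<ge> 1"
  shows "N n i \<in> measurable (row_sigma S) (count_space UNIV)"
proof -
  have "N n i -` {a} \<inter> space M \<in> row_cylinders n" for a
  proof -
    have "N n i -` {a} \<inter> space M = row_cylinder n {i} (\<lambda>_. a)" by (auto simp: row_cylinder_def)
    then show ?thesis using assms(2) unfolding row_cylinders_def by blast
  qed
  then show ?thesis
    using assms(1)
    by (subst measurable_count_space_eq2_countable)
       (auto simp: space_row_sigma sets_row_sigma intro!: sigma_sets.Basic)
qed

lemma row_sum_measurable:
  assumes "n \<in> S"
  shows "(\<lambda>\<omega>. \<Sum>l = 1..i. N n l \<omega>) \<in> measurable (row_sigma S) (count_space UNIV)"
proof (induction i)
  case (Suc i)
  have "(\<lambda>\<omega>. (\<lambda>a \<omega>. a + N n (Suc i) \<omega>) (\<Sum>l = 1..i. N n l \<omega>) \<omega>)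
      \<in> measurable (row_sigma S) (count_space UNIV)"
    by (rule measurable_compose_countable[OF _ Suc],
        rule measurable_compose[OF N_measurable_row_cylinders[OF assms]]) auto
  then show ?case by simp
qed simp

lemma bp_measurable_past:
  "bp N k n \<in> measurable (row_sigma {..<n}) (count_space UNIV)"
proof (induction n)
  case (Suc n)
  have "bp N k n \<in> measurable (row_sigma {..<Suc n}) (count_space UNIV)"
    using Suc row_sigma_mono[of "{..<n}" "{..<Suc n}"] by (auto simp: measurable_def space_row_sigma)
  then have "(\<lambda>\<omega>. (\<lambda>i \<omega>. \<Sum>l = 1..i. N n l \<omega>) (bp N k n \<omega>) \<omega>) \<in> measurable (row_sigma {..<Suc n}) (count_space UNIV)"
    by (rule measurable_compose_countable[rotated]) (rule row_sum_measurable, simp)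
  then show ?case by simp
qed simp

lemma bp_measurable [measurable]: "bp N k n \<in> measurable M (count_space UNIV)"
  using bp_measurable_past[of k n] row_sigma_sub[of "{..<n}"] by (auto simp: measurable_def space_row_sigma)

text \<open>
  Carrying along prescribed values \<open>c\<close> for further variables of the same row makes the induction on
  the number of summands possible: conditioning on the value of the last summand moves it into \<open>L\<close>.
\<close>

lemma prob_row_sum_and_cylinder:
  assumes "finite L" "L \<subseteq> {Suc i..}"
  shows "{\<omega> \<in> space M. (\<Sum>l = 1..i. N n l \<omega>) = j \<and> (\<forall>l\<in>L. N n l \<omega> = c l)} \<in> sets M \<and>
    prob {\<omega> \<in> space M. (\<Sum>l = 1..i. N n l \<omega>) = j \<and> (\<forall>l\<in>L. N n l \<omega> = c l)}
     = (\<integral>\<omega>. offspring_sum_prob (p (\<xi> n \<omega>)) i j * (\<Prod>l\<in>L. pmf (p (\<xi> n \<omega>)) (c l)) \<partial>M)"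
  using assms
proof (induction i arbitrary: j L c)
  case 0
  then have L: "finite L" "L \<subseteq> {1..}" by auto
  show ?case
  proof (cases "j = 0")
    case True
    then show ?thesis
      using prob_row_cylinder[OF L, of n c] row_cylinder_in_events[OF L, of n c]
      by (simp add: row_cylinder_def)
  qed simp
next
  case (Suc i)
  let ?A = "\<lambda>a. {\<omega> \<in> space M. (\<Sum>l = 1..i. N n l \<omega>) = j - a \<and>
    (\<forall>l\<in>insert (Suc i) L. N n l \<omega> = (c(Suc i := a)) l)}"
  have notin: "Suc i \<notin> L" using Suc.prems by auto
  have IH: "?A a \<in> sets M"
    "prob (?A a) = (\<integral>\<omega>. offspring_sum_prob (p (\<xi> n \<omega>)) i (j - a) *
       (\<Prod>l\<in>insert (Suc i) L. pmf (p (\<xi> n \<omega>)) ((c(Suc i := a)) l)) \<partial>M)" for a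
    using Suc.IH[of "insert (Suc i) L" "j - a" "c(Suc i := a)"] Suc.prems by fastforce+
  have prod_eq: "(\<Prod>l\<in>insert (Suc i) L. pmf D ((c(Suc i := a)) l)) = pmf D a * (\<Prod>l\<in>L. pmf D (c l))" for a D
  proof -
    have "(\<Prod>l\<in>L. pmf D ((c(Suc i := a)) l)) = (\<Prod>l\<in>L. pmf D (c l))"
      using notin by (intro prod.cong) auto
    then show ?thesis using notin Suc.prems(1) by simp
  qed
  have eq: "{\<omega> \<in> space M. (\<Sum>l = 1..Suc i. N n l \<omega>) = j \<and> (\<forall>l\<in>L. N n l \<omega> = c l)} = (\<Union>a\<in>{..j}. ?A a)"
    using notin by auto
  have disj: "disjoint_family_on ?A {..j}" by (auto simp: disjoint_family_on_def)
  have "prob (\<Union>a\<in>{..j}. ?A a) = (\<Sum>a\<le>j. prob (?A a))"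
    by (rule finite_measure_finite_Union[OF _ _ disj]) (use IH(1) in blast)+
  also have "\<dots> = (\<Sum>a\<le>j. \<integral>\<omega>. pmf (p (\<xi> n \<omega>)) a * offspring_sum_prob (p (\<xi> n \<omega>)) i (j - a) *
       (\<Prod>l\<in>L. pmf (p (\<xi> n \<omega>)) (c l)) \<partial>M)"
    unfolding IH(2) prod_eq by (simp add: mult_ac)
  also have "\<dots> = (\<integral>\<omega>. (\<Sum>a\<le>j. pmf (p (\<xi> n \<omega>)) a * offspring_sum_prob (p (\<xi> n \<omega>)) i (j - a) *
       (\<Prod>l\<in>L. pmf (p (\<xi> n \<omega>)) (c l))) \<partial>M)"
  proof (rule Bochner_Integration.integral_sum[symmetric])
    fix a
    show "integrable M (\<lambda>\<omega>. pmf (p (\<xi> n \<omega>)) a * offspring_sum_prob (p (\<xi> n \<omega>)) i (j - a) *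
       (\<Prod>l\<in>L. pmf (p (\<xi> n \<omega>)) (c l)))"
      by (rule integrable_const_bound[where B = 1])
         (auto simp: offspring_sum_prob_nonneg abs_mult abs_prod pmf_le_1 offspring_sum_prob_le_1
           intro!: mult_le_one prod_nonneg prod_le_1 mult_nonneg_nonneg)
  qed
  finally have "prob (\<Union>a\<in>{..j}. ?A a) = \<dots>" .
  moreover have "(\<Union>a\<in>{..j}. ?A a) \<in> sets M"
    by (rule sets.finite_UN) (use IH(1) in blast)+
  ultimately show ?case
    unfolding eq offspring_sum_prob_Suc sum_distrib_right by (rule conjI[rotated])
qed

text \<open>
  The annealed one-step transition probability \<open>p(i, j)\<close>, expressed through the environment alone.
\<close>

definition trans_prob :: "nat \<Rightarrow> nat \<Rightarrow> real" where
  "trans_prob i j = (\<integral>\<omega>. offspring_sum_prob (p (\<xi> 0 \<omega>)) i j \<partial>M)"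

lemma prob_row_sum:
  "prob {\<omega> \<in> space M. (\<Sum>l = 1..i. N n l \<omega>) = j} = trans_prob i j"
  using prob_row_sum_and_cylinder[of "{}" i n j "\<lambda>_. 0"] integral_env_eq[OF offspring_sum_prob_measurable]
  by (simp add: trans_prob_def)

lemma bp_prob_1: "bp_prob M N i 1 j = trans_prob i j"
proof -
  have "bp N i 1 \<omega> = (\<Sum>l = 1..i. N 0 l \<omega>)" for \<omega> by simp
  then show ?thesis unfolding bp_prob_def by (simp only: prob_row_sum)
qed

text \<open>
  The Markov property: \<open>{Z\<^sub>n = i}\<close> lies in the past, and on this event \<open>Z\<^sub>n\<^sub>+\<^sub>1\<close> is the sum of the first
  \<open>i\<close> variables of row \<open>n\<close>, which is independent of the past.
\<close>

lemma bp_prob_Suc_sums: "(\<lambda>i. bp_prob M N k n i * trans_prob i j) sums bp_prob M N k (Suc n) j"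
proof -
  let ?Z = "\<lambda>i. {\<omega> \<in> space M. bp N k n \<omega> = i}"
  let ?R = "\<lambda>i. {\<omega> \<in> space M. (\<Sum>l = 1..i. N n l \<omega>) = j}"
  have Z: "?Z i \<in> sets (row_sigma {..<n})" for i
    using measurable_sets[OF bp_measurable_past, of "{i}" k n]
    by (simp add: space_row_sigma vimage_def Int_def conj_commute)
  have R: "?R i \<in> sets (row_sigma {n})" for i
    using measurable_sets[OF row_sum_measurable[of n "{n}" i], of "{j}"]
    by (simp add: space_row_sigma vimage_def Int_def conj_commute)
  have "indep_sets (\<lambda>b. sigma_sets (space M) (\<Union>m\<in>(if b then {..<n} else {n}). row_cylinders m)) UNIV"
    by (rule indep_sets_collect_sigma)
       (auto simp: disjoint_family_on_def row_cylinders_Int_stable intro: indep_sets_mono_index[OF _ rows_indep])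
  then have indep: "indep_set (sets (row_sigma {..<n})) (sets (row_sigma {n}))"
    unfolding indep_set_def
    by (rule indep_sets_mono_sets) (auto split: bool.split simp: sets_row_sigma)
  have prob: "prob (?Z i \<inter> ?R i) = bp_prob M N k n i * trans_prob i j" for i
    using indep_setD[OF indep Z R] prob_row_sum by (simp add: bp_prob_def)
  have ZR: "?Z i \<inter> ?R i \<in> sets M" for i
    using Z[of i] R[of i] row_sigma_sub[of "{..<n}"] row_sigma_sub[of "{n}"] by (intro sets.Int) blast+
  have "(\<lambda>i. prob (?Z i \<inter> ?R i)) sums prob (\<Union>i. ?Z i \<inter> ?R i)"
    by (rule finite_measure_UNION) (use ZR in blast, auto simp: disjoint_family_on_def)
  moreover have "(\<Union>i. ?Z i \<inter> ?R i) = {\<omega> \<in> space M. bp N k (Suc n) \<omega> = j}" by auto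
  ultimately show ?thesis unfolding prob by (simp add: bp_prob_def)
qed

end

section \<open>Environments without extinction\<close>

text \<open>
  If \<open>p\<^sub>1 \<in> {0, 1}\<close> almost surely, then \<open>m\<^sub>0 powr (- r) - p\<^sub>1\<close> is zero on \<open>{p\<^sub>1 = 1}\<close> and positive on
  \<open>{p\<^sub>1 = 0}\<close>. Its mean vanishes, which forces \<open>p\<^sub>1 = 1\<close> almost surely.
\<close>

lemma (in branching_random_environment) harmonic_solution_imp_nondegenerate:
  assumes no_death: "AE \<omega> in M. pmf (p (\<xi> 0 \<omega>)) 0 = 0"
    and mean_finite: "AE \<omega> in M. summable (\<lambda>i. real i * pmf (p (\<xi> 0 \<omega>)) i)"
    and less: "(\<integral>\<omega>. pmf (p (\<xi> 0 \<omega>)) 1 \<partial>M) < 1"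
    and r: "r > 0" "(\<integral>\<omega>. pmf (p (\<xi> 0 \<omega>)) 1 \<partial>M) = (\<integral>\<omega>. offspring_mean (p (\<xi> 0 \<omega>)) powr (- r) \<partial>M)"
  shows "\<not> (AE \<omega> in M. pmf (p (\<xi> 0 \<omega>)) 1 \<in> {0, 1})"
proof
  let ?m = "\<lambda>\<omega>. offspring_mean (p (\<xi> 0 \<omega>)) powr (- r)" and ?p1 = "\<lambda>\<omega>. pmf (p (\<xi> 0 \<omega>)) 1"
  assume "AE \<omega> in M. ?p1 \<omega> \<in> {0, 1}"
  then have cases: "AE \<omega> in M. ?p1 \<omega> = 1 \<and> ?m \<omega> = 1 \<or> ?p1 \<omega> = 0 \<and> 0 < ?m \<omega> \<and> ?m \<omega> \<le> 1"
    using no_death mean_finite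
  proof eventually_elim
    case (elim \<omega>)
    have m: "offspring_mean (p (\<xi> 0 \<omega>)) \<ge> 1" using elim by (intro offspring_mean_ge_1)
    then have "0 < ?m \<omega>" "?m \<omega> \<le> 1"
      using powr_mono2'[of "- r" 1 "offspring_mean (p (\<xi> 0 \<omega>))"] r(1) by auto
    then show ?case using elim(1) offspring_mean_eq_1[of "p (\<xi> 0 \<omega>)"] by auto
  qed
  have [measurable]: "?m \<in> borel_measurable M"
    unfolding offspring_mean_def by measurable
  have int: "integrable M ?m" "integrable M ?p1"
    by (rule integrable_const_bound[where B = 1], rule eventually_mono[OF cases], auto)+
  have f: "AE \<omega> in M. ?m \<omega> - ?p1 \<omega> \<ge> 0" using cases by (rule eventually_mono) auto
  have "(\<integral>\<omega>. ?m \<omega> - ?p1 \<omega> \<partial>M) = 0"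
    using r(2) by (subst Bochner_Integration.integral_diff[OF int]) simp
  then have "AE \<omega> in M. ?m \<omega> - ?p1 \<omega> = 0"
    by (subst (asm) integral_nonneg_eq_0_iff_AE[OF Bochner_Integration.integrable_diff[OF int] f])
  then have "AE \<omega> in M. ?p1 \<omega> = 1"
    using cases by eventually_elim auto
  then have "(\<integral>\<omega>. ?p1 \<omega> \<partial>M) = (\<integral>\<omega>. 1 \<partial>M)" by (intro integral_cong_AE) auto
  then show False using less by (simp add: prob_space)
qed

text \<open>
  The last assumption guarantees that the numbers \<open>\<E>[p\<^sub>1(\<xi>\<^sub>0)^i]\<close> strictly decrease in \<open>i\<close>.
\<close>

locale immortal_environment = branching_random_environment +
  assumes no_death: "AE \<omega> in M. pmf (p (\<xi> 0 \<omega>)) 0 = 0"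
    and mean_finite: "AE \<omega> in M. summable (\<lambda>i. real i * pmf (p (\<xi> 0 \<omega>)) i)"
    and nondegenerate: "\<not> (AE \<omega> in M. pmf (p (\<xi> 0 \<omega>)) 1 \<in> {0, 1})"
begin

lemma trans_prob_nonneg: "trans_prob i j \<ge> 0"
  unfolding trans_prob_def by (intro integral_nonneg_AE) (simp add: offspring_sum_prob_nonneg)

lemma integrable_offspring_sum_prob:
  "integrable M (\<lambda>\<omega>. offspring_sum_prob (p (\<xi> 0 \<omega>)) i j)"
  by (rule integrable_const_bound[where B = 1])
     (auto simp: offspring_sum_prob_nonneg offspring_sum_prob_le_1)

lemma trans_prob_le_1: "trans_prob i j \<le> 1"
proof -
  have "trans_prob i j \<le> (\<integral>\<omega>. 1 \<partial>M)"
    unfolding trans_prob_def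
    by (intro integral_mono integrable_offspring_sum_prob) (auto simp: offspring_sum_prob_le_1)
  then show ?thesis by (simp add: prob_space)
qed

lemma trans_prob_0: "trans_prob 0 j = (if j = 0 then 1 else 0)"
  by (simp add: trans_prob_def prob_space)

lemma trans_prob_upper: "j < i \<Longrightarrow> trans_prob i j = 0"
  unfolding trans_prob_def using no_death
  by (intro integral_eq_zero_AE) (auto elim!: eventually_mono simp: offspring_sum_prob_eq_0)

lemma trans_prob_diag: "trans_prob i i = (\<integral>\<omega>. pmf (p (\<xi> 0 \<omega>)) 1 ^ i \<partial>M)"
  unfolding trans_prob_def using no_death
  by (intro integral_cong_AE) (auto elim!: eventually_mono simp: offspring_sum_prob_diag)

lemma integrable_p1_power: "integrable M (\<lambda>\<omega>. pmf (p (\<xi> 0 \<omega>)) 1 ^ i)"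
  by (rule integrable_const_bound[where B = 1]) (auto intro!: power_le_one pmf_le_1)

lemma trans_prob_diag_pos: "trans_prob i i > 0"
proof (rule ccontr)
  assume "\<not> trans_prob i i > 0"
  then have "trans_prob i i = 0"
    using trans_prob_nonneg[of i i] by linarith
  then have "(\<integral>\<omega>. pmf (p (\<xi> 0 \<omega>)) 1 ^ i \<partial>M) = 0"
    unfolding trans_prob_diag .
  then have "AE \<omega> in M. pmf (p (\<xi> 0 \<omega>)) 1 ^ i = 0"
    by (subst (asm) integral_nonneg_eq_0_iff_AE[OF integrable_p1_power]) auto
  then have "AE \<omega> in M. pmf (p (\<xi> 0 \<omega>)) 1 \<in> {0, 1}"
    by (rule eventually_mono) simp
  then show False using nondegenerate by blast
qed

text \<open>
  The non-negative variable \<open>p\<^sub>1^i - p\<^sub>1^j\<close> vanishes only where \<open>p\<^sub>1 \<in> {0, 1}\<close>, so its mean is positive.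
\<close>

lemma trans_prob_diag_less:
  assumes "i < j"
  shows "trans_prob j j < trans_prob i i"
proof (rule ccontr)
  let ?f = "\<lambda>\<omega>. pmf (p (\<xi> 0 \<omega>)) 1 ^ i - pmf (p (\<xi> 0 \<omega>)) 1 ^ j"
  have f: "?f \<omega> \<ge> 0" for \<omega>
    using assms by (auto intro!: power_decreasing pmf_le_1)
  have int: "integrable M ?f" by (intro Bochner_Integration.integrable_diff integrable_p1_power)
  have "(\<integral>\<omega>. ?f \<omega> \<partial>M) = trans_prob i i - trans_prob j j"
    unfolding trans_prob_diag by (intro Bochner_Integration.integral_diff integrable_p1_power)
  moreover assume "\<not> ?thesis"
  moreover have "(\<integral>\<omega>. ?f \<omega> \<partial>M) \<ge> 0" using f by (intro integral_nonneg_AE) auto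
  ultimately have "(\<integral>\<omega>. ?f \<omega> \<partial>M) = 0" by linarith
  then have "AE \<omega> in M. ?f \<omega> = 0"
    by (subst (asm) integral_nonneg_eq_0_iff_AE[OF int]) (use f in auto)
  then have "AE \<omega> in M. pmf (p (\<xi> 0 \<omega>)) 1 \<in> {0, 1}"
  proof (rule eventually_mono)
    fix \<omega>
    let ?x = "pmf (p (\<xi> 0 \<omega>)) 1"
    assume "?f \<omega> = 0"
    then have "?x ^ i * (1 - ?x ^ (j - i)) = 0"
      using assms power_add[of ?x i "j - i"] by (simp add: right_diff_distrib)
    then have "?x = 0 \<or> ?x ^ (j - i) = 1" by auto
    moreover have "?x = 1" if "?x ^ (j - i) = 1"
      using that assms pmf_nonneg[of "p (\<xi> 0 \<omega>)" 1]
      by (metis power_eq_1_iff real_norm_def abs_of_nonneg zero_less_diff neq0_conv)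
    ultimately show "?x \<in> {0, 1}" by blast
  qed
  then show False using nondegenerate by blast
qed

sublocale triangular_kernel trans_prob k for k
  by unfold_locales (auto simp: trans_prob_nonneg trans_prob_upper trans_prob_diag_pos trans_prob_diag_less)

lemma bp_prob_eq_row: "bp_prob M N k n j = row k n j"
proof (induction n arbitrary: j)
  case 0
  show ?case by (auto simp: bp_prob_def prob_space)
next
  case (Suc n)
  have "(\<lambda>i. bp_prob M N k n i * trans_prob i j) sums (\<Sum>i\<le>j. bp_prob M N k n i * trans_prob i j)"
    by (rule sums_finite) (auto simp: trans_prob_upper not_le)
  then show ?case using bp_prob_Suc_sums[of k n j] Suc by (simp add: sums_unique2)
qed

lemma bp_gamma_eq: "bp_gamma M N k = trans_prob k k"
  by (simp add: bp_gamma_def bp_prob_1 del: One_nat_def)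

lemma bp_prob_sums_1: "bp_prob M N k n sums 1"
proof -
  have "(\<lambda>j. prob {\<omega> \<in> space M. bp N k n \<omega> = j}) sums prob (\<Union>j. {\<omega> \<in> space M. bp N k n \<omega> = j})"
    by (rule finite_measure_UNION) (auto simp: disjoint_family_on_def)
  moreover have "(\<Union>j. {\<omega> \<in> space M. bp N k n \<omega> = j}) = space M" by auto
  moreover have "bp_prob M N k n = (\<lambda>j. prob {\<omega> \<in> space M. bp N k n \<omega> = j})"
    by (rule ext) (simp add: bp_prob_def)
  ultimately show ?thesis by (simp add: prob_space)
qed

lemma bp_pgf_sums:
  assumes t: "0 \<le> t" "t < 1"
  shows "(\<lambda>j. bp_prob M N k n j * t ^ j) sums bp_pgf M N k n t"
proof -
  let ?Z = "\<lambda>j. {\<omega> \<in> space M. bp N k n \<omega> = j}"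
  let ?f = "\<lambda>j \<omega>. indicator (?Z j) \<omega> * t ^ j :: real"
  have Z: "?Z j \<in> sets M" for j by measurable
  have int: "integrable M (?f j)" for j
    by (rule integrable_mult_left) (use Z in \<open>simp add: emeasure_finite less_top[symmetric]\<close>)
  have eq: "(\<integral>\<omega>. ?f j \<omega> \<partial>M) = bp_prob M N k n j * t ^ j" for j
    using Z[of j] by (simp add: bp_prob_def sets.sets_into_space Int_absorb2)
  have at: "(\<lambda>j. ?f j \<omega>) sums (t ^ bp N k n \<omega>)" if "\<omega> \<in> space M" for \<omega>
  proof -
    have "(\<lambda>j. ?f j \<omega>) = (\<lambda>j. if j = bp N k n \<omega> then t ^ j else 0)"
      using that by (auto simp: indicator_def)
    then show ?thesis using sums_single[of "bp N k n \<omega>" "\<lambda>j. t ^ j"] by simp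
  qed
  have norm: "norm (?f j \<omega>) = ?f j \<omega>" for j \<omega> using t by simp
  have "(\<lambda>j. \<integral>\<omega>. ?f j \<omega> \<partial>M) sums (\<integral>\<omega>. (\<Sum>j. ?f j \<omega>) \<partial>M)"
  proof (rule sums_integral[OF int])
    show "AE \<omega> in M. summable (\<lambda>j. norm (?f j \<omega>))"
      unfolding norm using at by (auto intro!: AE_I2 sums_summable)
    show "summable (\<lambda>j. \<integral>\<omega>. norm (?f j \<omega>) \<partial>M)"
      unfolding norm eq
    proof (rule summable_comparison_test'[OF summable_geometric[of t]])
      show "norm (bp_prob M N k n j * t ^ j) \<le> t ^ j" for j
        using t by (auto simp: bp_prob_def abs_mult intro!: mult_left_le_one_le)
    qed (use t in simp)
  qed
  also have "(\<integral>\<omega>. (\<Sum>j. ?f j \<omega>) \<partial>M) = bp_pgf M N k n t"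
    unfolding bp_pgf_def using at by (intro Bochner_Integration.integral_cong) (auto simp: sums_iff)
  finally show ?thesis by (simp only: eq)
qed

lemma pgf_env_measurable [measurable]:
  "(\<lambda>\<omega>. offspring_pgf (p (\<xi> 0 \<omega>)) t) \<in> borel_measurable M"
  unfolding offspring_pgf_def by measurable

lemma mean_env_measurable [measurable]:
  "(\<lambda>\<omega>. offspring_mean (p (\<xi> 0 \<omega>))) \<in> borel_measurable M"
  unfolding offspring_mean_def by measurable

lemma pgf_env_bounds:
  assumes "0 \<le> t" "t < 1"
  shows "AE \<omega> in M. 0 \<le> offspring_pgf (p (\<xi> 0 \<omega>)) t \<and> offspring_pgf (p (\<xi> 0 \<omega>)) t \<le> t"
  using no_death assms by (auto elim!: eventually_mono intro!: offspring_pgf_nonneg offspring_pgf_le)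

lemma expectation_pgf_power:
  assumes t: "0 \<le> t" "t < 1"
  shows "(\<lambda>j. trans_prob i j * t ^ j) sums (\<integral>\<omega>. offspring_pgf (p (\<xi> 0 \<omega>)) t ^ i \<partial>M)"
proof -
  let ?f = "\<lambda>j \<omega>. offspring_sum_prob (p (\<xi> 0 \<omega>)) i j * t ^ j"
  have at: "(\<lambda>j. ?f j \<omega>) sums (offspring_pgf (p (\<xi> 0 \<omega>)) t ^ i)" for \<omega>
    by (rule offspring_sum_prob_sums) (use t in auto)
  have norm: "norm (?f j \<omega>) = ?f j \<omega>" for j \<omega> using t by (simp add: offspring_sum_prob_nonneg)
  have eq: "(\<integral>\<omega>. ?f j \<omega> \<partial>M) = trans_prob i j * t ^ j" for j
    by (simp add: trans_prob_def)
  have "(\<lambda>j. \<integral>\<omega>. ?f j \<omega> \<partial>M) sums (\<integral>\<omega>. (\<Sum>j. ?f j \<omega>) \<partial>M)"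
  proof (rule sums_integral)
    show "integrable M (?f j)" for j
      by (intro integrable_mult_left integrable_offspring_sum_prob)
    show "AE \<omega> in M. summable (\<lambda>j. norm (?f j \<omega>))"
      unfolding norm using at by (auto intro!: AE_I2 sums_summable)
    show "summable (\<lambda>j. \<integral>\<omega>. norm (?f j \<omega>) \<partial>M)"
      unfolding norm eq
    proof (rule summable_comparison_test'[OF summable_geometric[of t]])
      show "norm (trans_prob i j * t ^ j) \<le> t ^ j" for j
        using t trans_prob_nonneg trans_prob_le_1
        by (auto simp: abs_mult intro!: mult_left_le_one_le)
    qed (use t in simp)
  qed
  then show ?thesis unfolding eq using at by (simp add: sums_iff)
qed

text \<open>
  Since \<open>0 \<le> f\<^sub>0(t) \<le> t\<close>, the series \<open>\<Sum>i. a\<^sub>i f\<^sub>0(t)^i\<close> is dominated by the convergent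
  \<open>\<Sum>i. \<bar>a\<^sub>i\<bar> t^i\<close>, so expectation and summation may be exchanged; \<open>\<E>[f\<^sub>0(t)^i]\<close> is the generating
  function of row \<open>i\<close> of the transition matrix.
\<close>

lemma expectation_power_series:
  assumes a: "\<And>t. 0 \<le> t \<Longrightarrow> t < 1 \<Longrightarrow> summable (\<lambda>j. a j * t ^ j)" and t: "0 \<le> t" "t < 1"
  shows "integrable M (\<lambda>\<omega>. power_series a (offspring_pgf (p (\<xi> 0 \<omega>)) t))"
    and "(\<lambda>j. (\<Sum>i\<le>j. a i * trans_prob i j) * t ^ j) sums
           (\<integral>\<omega>. power_series a (offspring_pgf (p (\<xi> 0 \<omega>)) t) \<partial>M)"
proof -
  let ?f = "\<lambda>\<omega>. offspring_pgf (p (\<xi> 0 \<omega>)) t"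
  \<comment> \<open>Convergence at a point beyond \<open>t\<close> yields absolute convergence at \<open>t\<close>.\<close>
  obtain s where s: "t < s" "s < 1" using dense[OF t(2)] by blast
  have abs: "summable (\<lambda>i. \<bar>a i\<bar> * t ^ i)"
    using powser_insidea[OF a[of s], of t] s t by (simp add: abs_mult power_abs)
  have f: "AE \<omega> in M. 0 \<le> ?f \<omega> ^ i \<and> ?f \<omega> ^ i \<le> t ^ i" for i
    using pgf_env_bounds[OF t] by eventually_elim (auto intro: power_mono)
  have f_int: "integrable M (\<lambda>\<omega>. ?f \<omega> ^ i)" for i
    by (rule integrable_const_bound[where B = "t ^ i"]) (rule eventually_mono[OF f[of i]], auto)
  have f_le: "(\<integral>\<omega>. ?f \<omega> ^ i \<partial>M) \<le> t ^ i" for i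
  proof -
    have "(\<integral>\<omega>. ?f \<omega> ^ i \<partial>M) \<le> (\<integral>\<omega>. t ^ i \<partial>M)"
      by (rule integral_mono_AE[OF f_int]) (simp, rule eventually_mono[OF f[of i]], auto)
    then show ?thesis by (simp add: prob_space)
  qed
  have f_nonneg: "(\<integral>\<omega>. ?f \<omega> ^ i \<partial>M) \<ge> 0" for i
    by (rule integral_nonneg_AE, rule eventually_mono[OF f[of i]]) auto
  have int: "integrable M (\<lambda>\<omega>. a i * ?f \<omega> ^ i)" for i
    by (intro integrable_mult_right f_int)
  have norm: "(\<integral>\<omega>. norm (a i * ?f \<omega> ^ i) \<partial>M) = \<bar>a i\<bar> * (\<integral>\<omega>. ?f \<omega> ^ i \<partial>M)" for i
  proof -
    have "(\<integral>\<omega>. norm (a i * ?f \<omega> ^ i) \<partial>M) = (\<integral>\<omega>. \<bar>a i\<bar> * ?f \<omega> ^ i \<partial>M)"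
      by (intro integral_cong_AE)
         (measurable, measurable, rule eventually_mono[OF f[of i]], auto simp: abs_mult)
    then show ?thesis by simp
  qed
  have AE: "AE \<omega> in M. summable (\<lambda>i. norm (a i * ?f \<omega> ^ i))"
    using pgf_env_bounds[OF t]
  proof eventually_elim
    case (elim \<omega>)
    show ?case
      by (rule summable_comparison_test'[OF abs])
         (use elim in \<open>auto simp: abs_mult power_abs intro!: mult_left_mono power_mono\<close>)
  qed
  have sm: "summable (\<lambda>i. \<integral>\<omega>. norm (a i * ?f \<omega> ^ i) \<partial>M)"
    unfolding norm
    by (rule summable_comparison_test'[OF abs])
       (use f_le f_nonneg in \<open>auto simp: abs_mult intro!: mult_left_mono\<close>)
  show "integrable M (\<lambda>\<omega>. power_series a (?f \<omega>))"
    unfolding power_series_def by (rule integrable_suminf[OF int AE sm])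
  have E: "(\<integral>\<omega>. power_series a (?f \<omega>) \<partial>M) = (\<Sum>i. a i * (\<integral>\<omega>. ?f \<omega> ^ i \<partial>M))"
    unfolding power_series_def integral_suminf[OF int AE sm] by simp
  define g where "g i j = a i * (trans_prob i j * t ^ j)" for i j
  have g: "g i sums (a i * (\<integral>\<omega>. ?f \<omega> ^ i \<partial>M))" for i
    unfolding g_def by (intro sums_mult expectation_pgf_power t)
  have abs_g: "(\<lambda>j. \<bar>g i j\<bar>) sums (\<bar>a i\<bar> * (\<integral>\<omega>. ?f \<omega> ^ i \<partial>M))" for i
    using sums_mult[OF expectation_pgf_power[OF t], of "\<bar>a i\<bar>" i] t
    by (simp add: g_def abs_mult trans_prob_nonneg)
  have "(\<lambda>j. \<Sum>i\<le>j. g i j) sums (\<Sum>i. \<Sum>j. g i j)"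
  proof (rule triangular_double_sum)
    show "g i j = 0" if "j < i" for i j using that by (simp add: g_def trans_prob_upper)
    show "summable (\<lambda>j. \<bar>g i j\<bar>)" for i using abs_g by (rule sums_summable)
    show "summable (\<lambda>i. \<Sum>j. \<bar>g i j\<bar>)" using sm unfolding norm using abs_g by (simp add: sums_iff)
  qed
  moreover have "(\<Sum>i. \<Sum>j. g i j) = (\<integral>\<omega>. power_series a (?f \<omega>) \<partial>M)"
    using g by (simp add: E sums_iff)
  ultimately show "(\<lambda>j. (\<Sum>i\<le>j. a i * trans_prob i j) * t ^ j) sums (\<integral>\<omega>. power_series a (?f \<omega>) \<partial>M)"
    by (simp add: g_def sum_distrib_right mult.assoc)
qed

text \<open>
  Both sides of the functional equation are power series in \<open>t\<close>; equality on \<open>[0, 1)\<close> means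
  equality of coefficients.
\<close>

lemma solution_iff_eigen:
  assumes a: "\<And>t. 0 \<le> t \<Longrightarrow> t < 1 \<Longrightarrow> summable (\<lambda>j. a j * t ^ j)"
  shows "(\<forall>t\<in>{0..<1}. \<gamma> * power_series a t = (\<integral>\<omega>. power_series a (offspring_pgf (p (\<xi> 0 \<omega>)) t) \<partial>M))
     \<longleftrightarrow> (\<forall>j. \<gamma> * a j = (\<Sum>i\<le>j. a i * trans_prob i j))"
proof -
  have E: "(\<lambda>j. (\<Sum>i\<le>j. a i * trans_prob i j) * t ^ j) sums
      (\<integral>\<omega>. power_series a (offspring_pgf (p (\<xi> 0 \<omega>)) t) \<partial>M)" if "0 \<le> t" "t < 1" for t
    by (rule expectation_power_series(2)) (use a that in auto)
  show ?thesis
  proof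
  assume eq: "\<forall>t\<in>{0..<1}. \<gamma> * power_series a t = (\<integral>\<omega>. power_series a (offspring_pgf (p (\<xi> 0 \<omega>)) t) \<partial>M)"
  have "(\<lambda>j. \<gamma> * a j) = (\<lambda>j. \<Sum>i\<le>j. a i * trans_prob i j)"
  proof (rule powser_eq_imp_coeff_eq)
    fix t :: real assume t: "0 \<le> t" "t < 1"
    show "summable (\<lambda>j. \<gamma> * a j * t ^ j)" using summable_mult[OF a[OF t], of \<gamma>] by (simp add: mult.assoc)
    show "summable (\<lambda>j. (\<Sum>i\<le>j. a i * trans_prob i j) * t ^ j)" using E[OF t] by (simp add: sums_iff)
    show "(\<Sum>j. \<gamma> * a j * t ^ j) = (\<Sum>j. (\<Sum>i\<le>j. a i * trans_prob i j) * t ^ j)"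
      using E[OF t] eq t suminf_mult[OF a[OF t], of \<gamma>] by (auto simp: sums_iff power_series_def mult.assoc)
  qed
  then show "\<forall>j. \<gamma> * a j = (\<Sum>i\<le>j. a i * trans_prob i j)" by metis
next
  assume eq: "\<forall>j. \<gamma> * a j = (\<Sum>i\<le>j. a i * trans_prob i j)"
  show "\<forall>t\<in>{0..<1}. \<gamma> * power_series a t = (\<integral>\<omega>. power_series a (offspring_pgf (p (\<xi> 0 \<omega>)) t) \<partial>M)"
  proof
    fix t :: real assume "t \<in> {0..<1}"
    then have t: "0 \<le> t" "t < 1" by auto
    have "(\<lambda>j. \<gamma> * a j * t ^ j) sums (\<gamma> * power_series a t)"
      using sums_mult[OF summable_sums[OF a[OF t]], of \<gamma>] by (simp add: power_series_def mult.assoc)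
    then show "\<gamma> * power_series a t = (\<integral>\<omega>. power_series a (offspring_pgf (p (\<xi> 0 \<omega>)) t) \<partial>M)"
      using E[OF t] eq by (simp add: sums_unique2)
  qed
  qed
qed

section \<open>Harmonic moments and the radius of convergence\<close>

lemma mean_ge_1: "AE \<omega> in M. offspring_mean (p (\<xi> 0 \<omega>)) \<ge> 1"
  using no_death mean_finite by eventually_elim (rule offspring_mean_ge_1)

lemma mean_powr_bounds:
  assumes "s > 0"
  shows "AE \<omega> in M. 0 < offspring_mean (p (\<xi> 0 \<omega>)) powr (- s) \<and>
           offspring_mean (p (\<xi> 0 \<omega>)) powr (- s) \<le> 1"
  using mean_ge_1
proof eventually_elim
  case (elim \<omega>)
  then show ?case using powr_mono2'[of "- s" 1 "offspring_mean (p (\<xi> 0 \<omega>))"] assms by auto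
qed

lemma integrable_mean_powr:
  assumes "s > 0"
  shows "integrable M (\<lambda>\<omega>. offspring_mean (p (\<xi> 0 \<omega>)) powr (- s))"
  by (rule integrable_const_bound[where B = 1]) (rule eventually_mono[OF mean_powr_bounds[OF assms]], auto)

text \<open>
  As \<open>m\<^sub>0 \<ge> 1\<close>, the power \<open>m\<^sub>0 powr (- s)\<close> decreases in \<open>s\<close>, and strictly where \<open>m\<^sub>0 > 1\<close>. Positivity of
  the mean of \<open>ln m\<^sub>0\<close> says that this happens with positive probability.
\<close>

lemma mean_powr_strict_antimono:
  assumes ln: "integrable M (\<lambda>\<omega>. ln (offspring_mean (p (\<xi> 0 \<omega>))))"
      "(\<integral>\<omega>. ln (offspring_mean (p (\<xi> 0 \<omega>))) \<partial>M) > 0"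
    and s: "0 < r" "r < s"
  shows "(\<integral>\<omega>. offspring_mean (p (\<xi> 0 \<omega>)) powr (- s) \<partial>M)
       < (\<integral>\<omega>. offspring_mean (p (\<xi> 0 \<omega>)) powr (- r) \<partial>M)"
proof (rule ccontr)
  let ?m = "\<lambda>\<omega>. offspring_mean (p (\<xi> 0 \<omega>))"
  let ?f = "\<lambda>\<omega>. ?m \<omega> powr (- r) - ?m \<omega> powr (- s)"
  have int: "integrable M (\<lambda>\<omega>. ?m \<omega> powr (- r))" "integrable M (\<lambda>\<omega>. ?m \<omega> powr (- s))"
    using s by (auto intro: integrable_mean_powr)
  have f: "AE \<omega> in M. ?f \<omega> \<ge> 0"
    using mean_ge_1 by eventually_elim (use s in \<open>auto intro!: powr_mono\<close>)
  assume "\<not> ?thesis"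
  then have "(\<integral>\<omega>. ?f \<omega> \<partial>M) \<le> 0"
    by (subst Bochner_Integration.integral_diff[OF int]) simp
  moreover have "(\<integral>\<omega>. ?f \<omega> \<partial>M) \<ge> 0" by (rule integral_nonneg_AE[OF f])
  ultimately have "(\<integral>\<omega>. ?f \<omega> \<partial>M) = 0" by linarith
  then have "AE \<omega> in M. ?f \<omega> = 0"
    by (subst (asm) integral_nonneg_eq_0_iff_AE[OF Bochner_Integration.integrable_diff[OF int] f])
  then have "AE \<omega> in M. ln (?m \<omega>) = 0"
    using mean_ge_1
  proof eventually_elim
    case (elim \<omega>)
    have "\<not> ?m \<omega> > 1"
    proof
      assume "?m \<omega> > 1"
      with s have "?m \<omega> powr (- s) < ?m \<omega> powr (- r)"
        by (intro powr_less_mono) auto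
      with elim(1) show False by linarith
    qed
    then show ?case using elim(2) by simp
  qed
  then have "(\<integral>\<omega>. ln (?m \<omega>) \<partial>M) = 0" by (rule integral_eq_zero_AE)
  then show False using ln(2) by simp
qed

text \<open>
  An upper bound for \<open>\<E>\<^sub>i[(Z\<^sub>1 / i) powr (- s)]\<close>. The maximum with \<open>m\<^sub>0 powr (- s)\<close> is taken inside the
  expectation, where the integrand then converges for almost every environment.
\<close>

definition harmonic_ratio :: "real \<Rightarrow> nat \<Rightarrow> real" where
  "harmonic_ratio s i = (\<integral>\<omega>. max (offspring_harmonic (p (\<xi> 0 \<omega>)) s i)
      (offspring_mean (p (\<xi> 0 \<omega>)) powr (- s)) \<partial>M)"

lemma harmonic_env_measurable [measurable]:
  "(\<lambda>\<omega>. offspring_harmonic (p (\<xi> 0 \<omega>)) s i) \<in> borel_measurable M"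
  unfolding offspring_harmonic_def by measurable

lemma harmonic_max_bounds:
  assumes "s > 0" "i \<ge> 1"
  shows "AE \<omega> in M. norm (max (offspring_harmonic (p (\<xi> 0 \<omega>)) s i)
      (offspring_mean (p (\<xi> 0 \<omega>)) powr (- s))) \<le> 1"
  using no_death mean_powr_bounds[OF assms(1)]
proof eventually_elim
  case (elim \<omega>)
  then show ?case
    using summable_offspring_harmonic(2,3)[OF elim(1) assms] by auto
qed

lemma harmonic_ratio_tendsto:
  assumes s: "s > 0"
  shows "harmonic_ratio s \<longlonglongrightarrow> (\<integral>\<omega>. offspring_mean (p (\<xi> 0 \<omega>)) powr (- s) \<partial>M)"
proof -
  have "(\<lambda>i. harmonic_ratio s (Suc i)) \<longlonglongrightarrow> (\<integral>\<omega>. offspring_mean (p (\<xi> 0 \<omega>)) powr (- s) \<partial>M)"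
    unfolding harmonic_ratio_def
  proof (rule integral_dominated_convergence[where w = "\<lambda>_. 1"])
    show "AE \<omega> in M. (\<lambda>i. max (offspring_harmonic (p (\<xi> 0 \<omega>)) s (Suc i))
        (offspring_mean (p (\<xi> 0 \<omega>)) powr (- s))) \<longlonglongrightarrow> offspring_mean (p (\<xi> 0 \<omega>)) powr (- s)"
      using no_death mean_finite
      by eventually_elim (intro LIMSEQ_Suc offspring_harmonic_tendsto s)
    show "AE \<omega> in M. norm (max (offspring_harmonic (p (\<xi> 0 \<omega>)) s (Suc i))
        (offspring_mean (p (\<xi> 0 \<omega>)) powr (- s))) \<le> 1" for i
      by (rule harmonic_max_bounds[OF s]) simp
  qed simp_all
  then show ?thesis by (simp only: filterlim_sequentially_Suc)
qed

lemma trans_prob_harmonic_le: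
  assumes s: "s > 0"
  shows "(\<Sum>j<J. trans_prob i j * real j powr (- s)) \<le> real i powr (- s) * harmonic_ratio s i"
proof (cases "i = 0")
  case True
  then show ?thesis by (auto intro!: sum_nonpos simp: trans_prob_0)
next
  case False
  then have i: "i \<ge> 1" by simp
  let ?S = "\<lambda>\<omega>. \<Sum>j<J. offspring_sum_prob (p (\<xi> 0 \<omega>)) i j * (real j / real i) powr (- s)"
  let ?m = "\<lambda>\<omega>. max (offspring_harmonic (p (\<xi> 0 \<omega>)) s i) (offspring_mean (p (\<xi> 0 \<omega>)) powr (- s))"
  have "(\<Sum>j<J. trans_prob i j * real j powr (- s))
      = real i powr (- s) * (\<Sum>j<J. trans_prob i j * (real j / real i) powr (- s))"
    using i by (simp add: sum_distrib_left powr_divide field_simps)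
  also have "(\<Sum>j<J. trans_prob i j * (real j / real i) powr (- s)) = (\<integral>\<omega>. ?S \<omega> \<partial>M)"
    unfolding trans_prob_def
    by (subst Bochner_Integration.integral_sum) (auto intro!: integrable_mult_left integrable_offspring_sum_prob)
  also have "\<dots> \<le> harmonic_ratio s i"
    unfolding harmonic_ratio_def
  proof (rule integral_mono_AE)
    show "integrable M ?S"
      by (intro Bochner_Integration.integrable_sum integrable_mult_left integrable_offspring_sum_prob)
    show "integrable M ?m"
      by (rule integrable_const_bound[where B = 1, OF harmonic_max_bounds[OF s i]]) measurable
    show "AE \<omega> in M. ?S \<omega> \<le> ?m \<omega>"
      using no_death
    proof eventually_elim
      case (elim \<omega>)
      have "?S \<omega> \<le> offspring_harmonic (p (\<xi> 0 \<omega>)) s i"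
        unfolding offspring_harmonic_def
        by (rule sum_le_suminf[OF summable_offspring_harmonic(1)[OF elim s i]])
           (auto simp: offspring_sum_prob_nonneg)
      then show ?case by simp
    qed
  qed
  finally show ?thesis by (simp add: mult_left_mono)
qed

text \<open>
  The drift criterion with weight \<open>j powr (- s)\<close>. The hypothesis leaves room for a number \<open>d\<close>
  strictly between the limit of the harmonic ratios and \<open>\<gamma>\<^sub>k\<close>.
\<close>

lemma harmonic_sum_limit_row:
  assumes s: "s > 0" and less: "(\<integral>\<omega>. offspring_mean (p (\<xi> 0 \<omega>)) powr (- s) \<partial>M) < trans_prob k k"
  shows "summable (\<lambda>j. limit_row k j * real j powr (- s))"
proof -
  let ?c = "\<integral>\<omega>. offspring_mean (p (\<xi> 0 \<omega>)) powr (- s) \<partial>M"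
  have c: "?c \<ge> 0" by (intro integral_nonneg_AE) auto
  obtain d where d: "?c < d" "d < trans_prob k k" using dense[OF less] by blast
  have "eventually (\<lambda>i. harmonic_ratio s i < d) sequentially"
    using harmonic_ratio_tendsto[OF s] d(1) by (rule order_tendstoD)
  then obtain K where K: "\<And>i. i \<ge> K \<Longrightarrow> harmonic_ratio s i < d"
    by (auto simp: eventually_sequentially)
  show ?thesis
  proof (rule summable_weighted_limit_row[where h = "\<lambda>i. real i powr (- s) * harmonic_ratio s i" and K = K
        and \<theta> = "d / trans_prob k k"])
    show "(\<Sum>j<J. trans_prob i j * real j powr (- s)) \<le> real i powr (- s) * harmonic_ratio s i" for i J
      by (rule trans_prob_harmonic_le[OF s])
    have "d \<ge> 0" using d(1) c by linarith
    then show "0 \<le> d / trans_prob k k" "d / trans_prob k k < 1"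
      using d(2) trans_prob_diag_pos[of k] by auto
    fix i assume "i \<ge> K"
    then have "real i powr (- s) * harmonic_ratio s i \<le> real i powr (- s) * d"
      using K by (intro mult_left_mono) (auto intro: less_imp_le)
    then show "real i powr (- s) * harmonic_ratio s i \<le> d / trans_prob k k * trans_prob k k * real i powr (- s)"
      using trans_prob_diag_pos[of k] by (simp add: mult.commute)
  qed simp
qed

text \<open>
  The geometric weight \<open>t^j\<close> eventually falls below the polynomial weight \<open>j powr (- s)\<close>.
\<close>

lemma summable_limit_row:
  assumes s: "s > 0" and hs: "summable (\<lambda>j. limit_row k j * real j powr (- s))"
    and t: "0 \<le> t" "t < 1"
  shows "summable (\<lambda>j. limit_row k j * t ^ j)"
proof (rule summable_comparison_test_ev[OF _ hs])
  have "(\<lambda>j. real j powr s * t ^ j) \<longlonglongrightarrow> 0"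
  proof (cases "t = 0")
    case False
    with t have "0 < t" by simp
    with t(2) show ?thesis by real_asymp
  qed (auto intro!: tendsto_eventually eventually_mono[OF eventually_gt_at_top[of 0]])
  then have "eventually (\<lambda>j. real j powr s * t ^ j < 1) sequentially"
    by (rule order_tendstoD) simp
  then show "eventually (\<lambda>j. norm (limit_row k j * t ^ j) \<le> limit_row k j * real j powr (- s)) sequentially"
    using eventually_gt_at_top[of 0]
  proof eventually_elim
    case (elim j)
    then have "t ^ j \<le> real j powr (- s)"
      by (simp add: powr_minus field_simps)
    then show ?case using t by (simp add: limit_row_nonneg mult_left_mono)
  qed
qed

section \<open>Generating functions, the recurrence and the functional equation\<close>

lemma bp_pgf_scaled_sums:
  assumes "0 \<le> t" "t < 1"
  shows "(\<lambda>j. scaled_row k n j * t ^ j) sums (bp_pgf M N k n t / trans_prob k k ^ n)"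
  using sums_divide[OF bp_pgf_sums[OF assms, of k n], of "trans_prob k k ^ n"]
  by (simp add: scaled_row_def bp_prob_eq_row)

lemma bp_pgf_scaled_incseq:
  assumes "0 \<le> t" "t < 1"
  shows "incseq (\<lambda>n. bp_pgf M N k n t / trans_prob k k ^ n)"
proof (rule incseq_SucI)
  fix n
  show "bp_pgf M N k n t / trans_prob k k ^ n \<le> bp_pgf M N k (Suc n) t / trans_prob k k ^ Suc n"
    by (rule sums_le[OF _ bp_pgf_scaled_sums[OF assms] bp_pgf_scaled_sums[OF assms]])
       (use incseq_SucD[OF scaled_row_incseq] assms in \<open>auto intro!: mult_right_mono\<close>)
qed

lemma bp_pgf_scaled_tendsto:
  assumes t: "0 \<le> t" "t < 1" and sm: "summable (\<lambda>j. limit_row k j * t ^ j)"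
  shows "(\<lambda>n. bp_pgf M N k n t / trans_prob k k ^ n) \<longlonglongrightarrow> power_series (limit_row k) t"
proof -
  have "(\<lambda>n. \<Sum>j. scaled_row k n j * t ^ j) \<longlonglongrightarrow> (\<Sum>j. limit_row k j * t ^ j)"
  proof (rule tannerys_theorem[THEN conjunct2, THEN conjunct2, OF _ _ sm])
    show "(\<lambda>n. scaled_row k n j * t ^ j) \<longlonglongrightarrow> limit_row k j * t ^ j" for j
      by (intro tendsto_mult_right scaled_row_tendsto)
    show "\<forall>\<^sub>F (j, n) in at_top \<times>\<^sub>F sequentially. norm (scaled_row k n j * t ^ j) \<le> limit_row k j * t ^ j"
      using t by (intro always_eventually)
         (auto simp: scaled_row_nonneg intro!: mult_right_mono scaled_row_le_limit_row)
  qed simp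
  then show ?thesis
    using bp_pgf_scaled_sums[OF t, of k] by (simp add: sums_iff power_series_def)
qed

text \<open>
  The limit dominates each scaled row, whose total mass is \<open>\<gamma>\<^sub>k^(-n)\<close>, and \<open>\<gamma>\<^sub>k < 1 = \<gamma>\<^sub>0\<close>.
\<close>

lemma not_summable_limit_row:
  assumes k: "k \<ge> 1"
  shows "\<not> summable (limit_row k)"
proof
  assume sm: "summable (limit_row k)"
  have \<gamma>: "0 < trans_prob k k" "trans_prob k k < 1"
    using trans_prob_diag_pos[of k] trans_prob_diag_less[of 0 k] k by (auto simp: trans_prob_0)
  have "(1 / trans_prob k k) ^ n \<le> suminf (limit_row k)" for n
  proof (rule sums_le)
    show "scaled_row k n sums ((1 / trans_prob k k) ^ n)"
      using sums_divide[OF bp_prob_sums_1[of k n], of "trans_prob k k ^ n"]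
      by (simp add: scaled_row_def[abs_def] bp_prob_eq_row power_one_over)
    show "limit_row k sums suminf (limit_row k)" using sm by (rule summable_sums)
  qed (rule scaled_row_le_limit_row)
  moreover obtain n where "suminf (limit_row k) < (1 / trans_prob k k) ^ n"
    using real_arch_pow[of "1 / trans_prob k k" "suminf (limit_row k)"] \<gamma> by auto
  ultimately show False by (meson not_le)
qed

lemma conv_radius_limit_row:
  assumes k: "k \<ge> 1" and sm: "\<And>t. 0 \<le> t \<Longrightarrow> t < 1 \<Longrightarrow> summable (\<lambda>j. limit_row k j * t ^ j)"
  shows "conv_radius (limit_row k) = 1"
proof (rule antisym)
  show "conv_radius (limit_row k) \<le> 1"
  proof (rule ccontr)
    assume "\<not> ?thesis"
    then have "summable (\<lambda>j. limit_row k j * 1 ^ j)"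
      by (intro summable_in_conv_radius) (simp add: one_ereal_def)
    then show False using not_summable_limit_row[OF k] by simp
  qed
  show "conv_radius (limit_row k) \<ge> 1"
    unfolding one_ereal_def
  proof (rule conv_radius_geI_ex')
    fix r :: real assume "0 < r" "ereal r < ereal 1"
    then show "summable (\<lambda>n. limit_row k n * of_real r ^ n)" using sm[of r] by simp
  qed
qed

text \<open>
  The eigenvector equation holds in every column, so the limit satisfies the recurrence, which asks
  for it at accessible states only. Conversely, the recurrence prescribes zero at all other states,
  and at accessible \<open>j > k\<close> it can be solved for \<open>q j\<close> since \<open>\<gamma>\<^sub>j \<noteq> \<gamma>\<^sub>k\<close>.
\<close>

lemma q_recurrence_iff: "q_recurrence M N k q \<longleftrightarrow> q = limit_row k"
proof -
  have acc: "accessible M N k j \<longleftrightarrow> limit_row k j > 0" for j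
    by (simp add: accessible_def bp_prob_eq_row limit_row_pos_iff)
  have sum_eq: "(\<Sum>i = k..j. bp_prob M N i 1 j * b i) = (\<Sum>i\<le>j. b i * trans_prob i j)"
    if "\<And>i. i < k \<Longrightarrow> b i = 0" for b :: "nat \<Rightarrow> real" and j
    unfolding bp_prob_1 by (rule sum.mono_neutral_cong_left) (use that in auto)
  have L: "q_recurrence M N k (limit_row k)"
    unfolding q_recurrence_def
    using limit_row_nonneg[of k] limit_row_eigen[of k] sum_eq[of "limit_row k"]
    by (auto simp: limit_row_at_k limit_row_less acc bp_gamma_eq not_less intro: antisym)
  have "q j = limit_row k j" if q: "q_recurrence M N k q" for q j
  proof (induction j rule: less_induct)
    case (less j)
    have q0: "\<And>i. i < k \<Longrightarrow> q i = 0" using q by (auto simp: q_recurrence_def)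
    show ?case
    proof (cases "accessible M N k j \<and> k < j")
      case True
      have split: "(\<Sum>i\<le>j. b i * trans_prob i j) = (\<Sum>i<j. b i * trans_prob i j) + b j * trans_prob j j"
        for b :: "nat \<Rightarrow> real" by (simp flip: lessThan_Suc_atMost)
      have "trans_prob k k * q j = (\<Sum>i\<le>j. q i * trans_prob i j)"
        using q True sum_eq[of q j, OF q0] by (simp add: q_recurrence_def bp_gamma_eq)
      then have "(trans_prob k k - trans_prob j j) * q j
          = (trans_prob k k - trans_prob j j) * limit_row k j"
        using limit_row_eigen[of k j] less unfolding split by (simp add: algebra_simps)
      then show ?thesis using trans_prob_diag_less[of k j] True by simp
    next
      case False
      then show ?thesis
        using q L by (cases "j = k") (auto simp: q_recurrence_def)
    qed
  qed
  then show ?thesis using L by blast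
qed

lemma solves_functional_equation_iff:
  assumes sm: "\<And>t. 0 \<le> t \<Longrightarrow> t < 1 \<Longrightarrow> summable (\<lambda>j. limit_row k j * t ^ j)"
  shows "solves_functional_equation M \<xi> p N k a \<longleftrightarrow> a = limit_row k"
proof
  assume a: "solves_functional_equation M \<xi> p N k a"
  then have "\<forall>j. trans_prob k k * a j = (\<Sum>i\<le>j. a i * trans_prob i j)"
    by (subst solution_iff_eigen[symmetric]) (auto simp: solves_functional_equation_def bp_gamma_eq)
  then show "a = limit_row k"
    using a trans_prob_diag_less
    by (intro eigen_unique) (auto simp: solves_functional_equation_def less_imp_neq[symmetric] dest: less_imp_neq)
next
  have "\<forall>t\<in>{0..<1}. trans_prob k k * power_series (limit_row k) t
      = (\<integral>\<omega>. power_series (limit_row k) (offspring_pgf (p (\<xi> 0 \<omega>)) t) \<partial>M)"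
    by (subst solution_iff_eigen) (use sm limit_row_eigen in auto)
  moreover assume "a = limit_row k"
  ultimately show "solves_functional_equation M \<xi> p N k a"
    using sm expectation_power_series(1)[of "limit_row k"]
    by (auto simp: solves_functional_equation_def bp_gamma_eq limit_row_at_k)
qed

lemma bp_prob_asymp:
  assumes "accessible M N k j"
  shows "limit_row k j > 0"
    and "(\<lambda>n. bp_prob M N k n j) \<sim>[sequentially] (\<lambda>n. trans_prob k k ^ n * limit_row k j)"
proof -
  show pos: "limit_row k j > 0"
    using assms by (simp add: accessible_def bp_prob_eq_row limit_row_pos_iff)
  have "(\<lambda>n. scaled_row k n j / limit_row k j) \<longlonglongrightarrow> limit_row k j / limit_row k j"
    using pos by (intro tendsto_intros scaled_row_tendsto) auto
  then show "(\<lambda>n. bp_prob M N k n j) \<sim>[sequentially] (\<lambda>n. trans_prob k k ^ n * limit_row k j)"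
    using pos by (intro asymp_equivI') (simp add: scaled_row_def bp_prob_eq_row)
qed

end

theorem theorem2p3:
  fixes M :: "'w measure"
    and E :: "'e measure"
    and \<xi> :: "nat \<Rightarrow> 'w \<Rightarrow> 'e"
    and p :: "'e \<Rightarrow> nat pmf"
    and N :: "nat \<Rightarrow> nat \<Rightarrow> 'w \<Rightarrow> nat"
    and r :: "nat \<Rightarrow> real"
  assumes bpre: "branching_random_environment M E \<xi> p N"
    and no_death: "AE \<omega> in M. pmf (p (\<xi> 0 \<omega>)) 0 = 0"
    (* E log m_0 in (0, oo), which in particular means m_0 < oo a.s. *)
    and mean_finite: "AE \<omega> in M. summable (\<lambda>i. real i * pmf (p (\<xi> 0 \<omega>)) i)"
    and log_mean_integrable: "integrable M (\<lambda>\<omega>. ln (offspring_mean (p (\<xi> 0 \<omega>))))"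
    and log_mean_pos: "(\<integral>\<omega>. ln (offspring_mean (p (\<xi> 0 \<omega>))) \<partial>M) > 0"
    and gamma_range: "bp_prob M N 1 1 1 \<in> {0..<1}"
    and gamma_pos: "bp_prob M N 1 1 1 > 0"
    and r_solution: "\<And>k. k \<ge> 1 \<Longrightarrow>
      r k > 0 \<and>
      bp_gamma M N k = (\<integral>\<omega>. offspring_mean (p (\<xi> 0 \<omega>)) powr (- r k) \<partial>M)"
  shows "\<forall>k\<ge>1.
    bp_gamma M N k = (\<integral>\<omega>. pmf (p (\<xi> 0 \<omega>)) 1 ^ k \<partial>M) \<and>
    bp_gamma M N k > 0 \<and>
    (\<exists>!q. q_recurrence M N k q) \<and>
    (\<forall>q. q_recurrence M N k q \<longrightarrow>
      \<comment> \<open>a)\<close>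
      (\<forall>j\<ge>k. accessible M N k j \<longrightarrow>
         q j > 0 \<and>
         (\<lambda>n. bp_prob M N k n j) \<sim>[sequentially] (\<lambda>n. bp_gamma M N k ^ n * q j)) \<and>
      \<comment> \<open>b)\<close>
      ((\<exists>\<epsilon>>0. integrable M (\<lambda>\<omega>. offspring_mean (p (\<xi> 0 \<omega>)) powr (r k + \<epsilon>))) \<longrightarrow>
         (\<forall>s>r k. (\<lambda>j. real j powr (- s) * q j) summable_on {k..}) \<and>
         conv_radius q = 1) \<and>
      \<comment> \<open>c)\<close>
      (\<forall>t\<in>{0..<1}.
         incseq (\<lambda>n. bp_pgf M N k n t / bp_gamma M N k ^ n) \<and>
         summable (\<lambda>j. q j * t ^ j) \<and>
         (\<lambda>n. bp_pgf M N k n t / bp_gamma M N k ^ n) \<longlonglongrightarrow> power_series q t) \<and>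
      \<comment> \<open>d)\<close>
      solves_functional_equation M \<xi> p N k q \<and>
      (\<forall>a. solves_functional_equation M \<xi> p N k a \<longrightarrow> a = q))"
proof -
  have nondegenerate: "\<not> (AE \<omega> in M. pmf (p (\<xi> 0 \<omega>)) 1 \<in> {0, 1})"
  proof -
    interpret branching_random_environment M E \<xi> p N by (rule bpre)
    have \<gamma>1: "bp_gamma M N 1 = (\<integral>\<omega>. pmf (p (\<xi> 0 \<omega>)) 1 \<partial>M)"
      unfolding bp_gamma_def bp_prob_1 trans_prob_def using no_death
      by (intro integral_cong_AE)
         (auto elim!: eventually_mono simp: offspring_sum_prob_diag[where i = 1, simplified])
    have "bp_gamma M N 1 < 1" using gamma_range by (simp add: bp_gamma_def)
    then show ?thesis
      using r_solution[of 1] unfolding \<gamma>1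
      by (intro harmonic_solution_imp_nondegenerate[OF no_death mean_finite, where r = "r 1"]) auto
  qed
  interpret branching_random_environment M E \<xi> p N by (rule bpre)
  interpret immortal_environment M E \<xi> p N
    by unfold_locales (fact no_death mean_finite nondegenerate)+
  show ?thesis
  proof (intro allI impI)
    fix k :: nat assume k: "k \<ge> 1"
    note \<gamma> = bp_gamma_eq[of k]
    have harmonic: "summable (\<lambda>j. limit_row k j * real j powr (- s))" if "s > r k" for s
    proof (rule harmonic_sum_limit_row)
      show "s > 0" using that r_solution[OF k] by linarith
      show "(\<integral>\<omega>. offspring_mean (p (\<xi> 0 \<omega>)) powr (- s) \<partial>M) < trans_prob k k"
        using mean_powr_strict_antimono[OF log_mean_integrable log_mean_pos _ that] r_solution[OF k]
        by (simp add: \<gamma>)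
    qed
    have sm: "summable (\<lambda>j. limit_row k j * t ^ j)" if "0 \<le> t" "t < 1" for t
      by (rule summable_limit_row[OF _ harmonic[of "r k + 1"] that]) (use r_solution[OF k] in auto)
    have on: "(\<lambda>j. real j powr (- s) * limit_row k j) summable_on {k..}" if "s > r k" for s
    proof -
      have "(\<lambda>j. limit_row k j * real j powr (- s)) summable_on UNIV"
        using harmonic[OF that] by (subst summable_on_UNIV_nonneg_real_iff) (auto simp: limit_row_nonneg)
      then show ?thesis by (auto simp: mult.commute intro: summable_on_subset_banach)
    qed
    have solution_iff: "solves_functional_equation M \<xi> p N k a \<longleftrightarrow> a = limit_row k" for a
      by (rule solves_functional_equation_iff) (rule sm)
    show "bp_gamma M N k = (\<integral>\<omega>. pmf (p (\<xi> 0 \<omega>)) 1 ^ k \<partial>M) \<and>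
      bp_gamma M N k > 0 \<and>
      (\<exists>!q. q_recurrence M N k q) \<and>
      (\<forall>q. q_recurrence M N k q \<longrightarrow>
        (\<forall>j\<ge>k. accessible M N k j \<longrightarrow>
           q j > 0 \<and>
           (\<lambda>n. bp_prob M N k n j) \<sim>[sequentially] (\<lambda>n. bp_gamma M N k ^ n * q j)) \<and>
        ((\<exists>\<epsilon>>0. integrable M (\<lambda>\<omega>. offspring_mean (p (\<xi> 0 \<omega>)) powr (r k + \<epsilon>))) \<longrightarrow>
           (\<forall>s>r k. (\<lambda>j. real j powr (- s) * q j) summable_on {k..}) \<and>
           conv_radius q = 1) \<and>
        (\<forall>t\<in>{0..<1}.
           incseq (\<lambda>n. bp_pgf M N k n t / bp_gamma M N k ^ n) \<and>
           summable (\<lambda>j. q j * t ^ j) \<and>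
           (\<lambda>n. bp_pgf M N k n t / bp_gamma M N k ^ n) \<longlonglongrightarrow> power_series q t) \<and>
        solves_functional_equation M \<xi> p N k q \<and>
        (\<forall>a. solves_functional_equation M \<xi> p N k a \<longrightarrow> a = q))"
      unfolding q_recurrence_iff solution_iff \<gamma>
      using trans_prob_diag_pos[of k] bp_prob_asymp[of k] on
        conv_radius_limit_row[OF k sm] bp_pgf_scaled_incseq[of _ k] bp_pgf_scaled_tendsto[OF _ _ sm] sm
      by (intro conjI trans_prob_diag[of k]) auto
  qed
qed

end
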